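(* Let $d_1,d_2>1$ and let $\Phi:\mathbb{M}_{d_1}\to\mathbb{M}_{d_2}$ be a CP-map. Then the following conditions are equivalent: (i) $\Phi$ is $2$-entanglement breaking. (ii) $SN(\Phi\circ\Psi)<SN(\Psi)$ for all $2\leq m\leq d_2$ and all CP-maps $\Psi:\mathbb{M}_m\to\mathbb{M}_{d_1}$ that are not entanglement breaking. (iii) $SN(\Phi\circ\Psi)<SN(\Psi)$ for all $m\geq2$ and all $d_2$-PEB maps $\Psi:\mathbb{M}_m\to\mathbb{M}_{d_1}$ that are not entanglement breaking. (iv) $SN(\Phi\circ\Psi)<SN(\Psi)$ for all CP-maps $\Psi:\mathbb{M}_2\to\mathbb{M}_{d_1}$ that are not entanglement breaking.
   Context: $\mathbb{M}_d$ is the algebra of complex $d\times d$ matrices; a superscript $+$ denotes the cone of positive semidefinite matrices. A linear map is positive if it preserves positive semidefiniteness, $k$-positive if its tensor product with the identity map $\mathrm{id}_k$ of $\mathbb{M}_k$ is positive, and completely positive (CP) if it is $k$-positive for all $k\ge1$. $X\in(\mathbb{M}_{m}\otimes\mathbb{M}_{n})^+$ is separable if $X=\sum_i A_i\otimes B_i$ (finite sum) with $A_i\in\mathbb{M}_m^+$, $B_i\in\mathbb{M}_n^+$. A linear map $\Phi:\mathbb{M}_{d_1}\to\mathbb{M}_{d_2}$ is entanglement breaking if $(\mathrm{id}_m\otimes\Phi)(X)$ is separable for all $m\ge1$, $X\in(\mathbb{M}_m\otimes\mathbb{M}_{d_1})^+$, and $k$-entanglement breaking if it is $k$-positive and $(\mathrm{id}_k\otimes\Phi)(X)$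 is separable for every $X\in(\mathbb{M}_k\otimes\mathbb{M}_{d_1})^+$. The Schmidt rank $SR(\xi)$ of $\xi\in\mathbb{C}^{m}\otimes\mathbb{C}^{n}$ is the number of nonzero coefficients in a Schmidt decomposition $\xi=\sum_i\lambda_i\,u_i\otimes v_i$ ($\{u_i\}$, $\{v_i\}$ orthonormal, $\lambda_i\ge0$). The Schmidt number of $X\in(\mathbb{M}_m\otimes\mathbb{M}_n)^+$ is $SN(X)=\min\max_i SR(\xi_i)$, the minimum being over all finite decompositions $X=\sum_i|\xi_i\rangle\langle\xi_i|$, where $|\xi\rangle\langle\xi|(z)=\xi\langle\xi,z\rangle$; $X$ is separable if and only if $SN(X)=1$ (in particular the zero matrix is counted as having Schmidt number $1$). For a CP-map $\Phi:\mathbb{M}_{d_1}\to\mathbb{M}_{d_2}$, $SN(\Phi):=SN(C_\Phi)$, where $C_\Phi=\sum_{i,j}E_{ij}\otimes\Phi(E_{ij})$ is the Choi matrix. A CP-map is $k$-partially entanglement breaking ($k$-PEB) if it has the form $X\mapsto\sum_iV_i^*XV_i$ with all $\mathrm{rank}(V_i)\le k$ (equivalently, its Schmidt number is at most $k$). *)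

theory Defs
  imports
    "Jordan_Normal_Form.DL_Rank"
    "Jordan_Normal_Form.Schur_Decomposition"
begin

(* The algebra of complex d x d matrices is carrier_mat d d. A map between matrix algebras is
   a HOL function whose values outside the carrier are irrelevant; its dimensions are passed
   explicitly. *)

definition mat_sum :: "nat \<Rightarrow> 'i set \<Rightarrow> ('i \<Rightarrow> complex mat) \<Rightarrow> complex mat" where
  "mat_sum d I F = mat d d (\<lambda>(a, b). \<Sum>i\<in>I. F i $$ (a, b))"

definition mat_unit :: "nat \<Rightarrow> nat \<Rightarrow> nat \<Rightarrow> complex mat" where
  "mat_unit d i j = mat d d (\<lambda>(a, b). if a = i \<and> b = j then 1 else 0)"

definition pos_semidef :: "nat \<Rightarrow> complex mat \<Rightarrow> bool" where
  "pos_semidef d X \<longleftrightarrow> X \<in> carrier_mat d d \<and> (\<forall>v\<in>carrier_vec d. 0 \<le> (X *\<^sub>v v) \<bullet>c v)"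

(* C^m (x) C^n is identified with C^(m*n) by e_i (x) e_j = e_(i*n+j), and likewise for
   matrices (Kronecker product). *)

definition tensor_vec :: "complex vec \<Rightarrow> complex vec \<Rightarrow> complex vec" where
  "tensor_vec u v = vec (dim_vec u * dim_vec v)
     (\<lambda>a. u $ (a div dim_vec v) * v $ (a mod dim_vec v))"

definition tensor_mat :: "complex mat \<Rightarrow> complex mat \<Rightarrow> complex mat" where
  "tensor_mat A B = mat (dim_row A * dim_row B) (dim_col A * dim_col B)
     (\<lambda>(a, b). A $$ (a div dim_row B, b div dim_col B) * B $$ (a mod dim_row B, b mod dim_col B))"

definition linear_map :: "nat \<Rightarrow> nat \<Rightarrow> (complex mat \<Rightarrow> complex mat) \<Rightarrow> bool" where
  "linear_map d1 d2 \<Phi> \<longleftrightarrow>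
     (\<forall>X\<in>carrier_mat d1 d1. \<Phi> X \<in> carrier_mat d2 d2) \<and>
     (\<forall>X\<in>carrier_mat d1 d1. \<forall>Y\<in>carrier_mat d1 d1. \<Phi> (X + Y) = \<Phi> X + \<Phi> Y) \<and>
     (\<forall>c. \<forall>X\<in>carrier_mat d1 d1. \<Phi> (c \<cdot>\<^sub>m X) = c \<cdot>\<^sub>m \<Phi> X)"

definition block :: "nat \<Rightarrow> complex mat \<Rightarrow> nat \<Rightarrow> nat \<Rightarrow> complex mat" where
  "block d X i j = mat d d (\<lambda>(a, b). X $$ (i * d + a, j * d + b))"

(* id_k (x) Phi: writing X = sum_ij E_ij (x) X_ij with blocks X_ij, its value at X is
   sum_ij E_ij (x) Phi(X_ij). *)
definition id_tensor ::
    "nat \<Rightarrow> nat \<Rightarrow> nat \<Rightarrow> (complex mat \<Rightarrow> complex mat) \<Rightarrow> complex mat \<Rightarrow> complex mat" where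
  "id_tensor k d1 d2 \<Phi> X =
     mat_sum (k * d2) ({..<k} \<times> {..<k})
       (\<lambda>(i, j). tensor_mat (mat_unit k i j) (\<Phi> (block d1 X i j)))"

definition positive_map :: "nat \<Rightarrow> nat \<Rightarrow> (complex mat \<Rightarrow> complex mat) \<Rightarrow> bool" where
  "positive_map d1 d2 \<Phi> \<longleftrightarrow>
     linear_map d1 d2 \<Phi> \<and> (\<forall>X. pos_semidef d1 X \<longrightarrow> pos_semidef d2 (\<Phi> X))"

definition k_positive :: "nat \<Rightarrow> nat \<Rightarrow> nat \<Rightarrow> (complex mat \<Rightarrow> complex mat) \<Rightarrow> bool" where
  "k_positive k d1 d2 \<Phi> \<longleftrightarrow>
     linear_map d1 d2 \<Phi> \<and> positive_map (k * d1) (k * d2) (id_tensor k d1 d2 \<Phi>)"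

definition completely_positive :: "nat \<Rightarrow> nat \<Rightarrow> (complex mat \<Rightarrow> complex mat) \<Rightarrow> bool" where
  "completely_positive d1 d2 \<Phi> \<longleftrightarrow> (\<forall>k\<ge>1. k_positive k d1 d2 \<Phi>)"

definition separable :: "nat \<Rightarrow> nat \<Rightarrow> complex mat \<Rightarrow> bool" where
  "separable m n X \<longleftrightarrow> pos_semidef (m * n) X \<and>
     (\<exists>(r::nat) A B. (\<forall>i<r. pos_semidef m (A i) \<and> pos_semidef n (B i)) \<and>
        X = mat_sum (m * n) {..<r} (\<lambda>i. tensor_mat (A i) (B i)))"

definition entanglement_breaking :: "nat \<Rightarrow> nat \<Rightarrow> (complex mat \<Rightarrow> complex mat) \<Rightarrow> bool" where
  "entanglement_breaking d1 d2 \<Phi> \<longleftrightarrow> linear_map d1 d2 \<Phi> \<and>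
     (\<forall>m\<ge>1. \<forall>X. pos_semidef (m * d1) X \<longrightarrow> separable m d2 (id_tensor m d1 d2 \<Phi> X))"

definition k_entanglement_breaking ::
    "nat \<Rightarrow> nat \<Rightarrow> nat \<Rightarrow> (complex mat \<Rightarrow> complex mat) \<Rightarrow> bool" where
  "k_entanglement_breaking k d1 d2 \<Phi> \<longleftrightarrow> k_positive k d1 d2 \<Phi> \<and>
     (\<forall>X. pos_semidef (k * d1) X \<longrightarrow> separable k d2 (id_tensor k d1 d2 \<Phi> X))"

definition orthonormal_family :: "nat \<Rightarrow> nat \<Rightarrow> (nat \<Rightarrow> complex vec) \<Rightarrow> bool" where
  "orthonormal_family d r u \<longleftrightarrow> (\<forall>i<r. u i \<in> carrier_vec d) \<and>
     (\<forall>i<r. \<forall>j<r. u i \<bullet>c u j = (if i = j then 1 else 0))"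

definition schmidt_decomposition ::
    "nat \<Rightarrow> nat \<Rightarrow> complex vec \<Rightarrow> nat \<Rightarrow> (nat \<Rightarrow> real) \<Rightarrow>
     (nat \<Rightarrow> complex vec) \<Rightarrow> (nat \<Rightarrow> complex vec) \<Rightarrow> bool" where
  "schmidt_decomposition m n \<xi> r l u v \<longleftrightarrow>
     orthonormal_family m r u \<and> orthonormal_family n r v \<and> (\<forall>i<r. 0 \<le> l i) \<and>
     \<xi> = finsum_vec TYPE(complex) (m * n)
           (\<lambda>i. complex_of_real (l i) \<cdot>\<^sub>v tensor_vec (u i) (v i)) {..<r}"

definition schmidt_rank :: "nat \<Rightarrow> nat \<Rightarrow> complex vec \<Rightarrow> nat" where
  "schmidt_rank m n \<xi> =
     (THE s. \<exists>r l u v. schmidt_decomposition m n \<xi> r l u v \<and> s = card {i. i < r \<and> l i \<noteq> 0})"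

definition rank_one :: "complex vec \<Rightarrow> complex mat" where
  "rank_one \<xi> = mat (dim_vec \<xi>) (dim_vec \<xi>) (\<lambda>(a, b). \<xi> $ a * conjugate (\<xi> $ b))"

(* A nonzero matrix only has decompositions containing a vector of Schmidt rank at least 1, so
   inserting 1 below affects nothing but the zero matrix (whose decompositions may be empty or
   consist of zero vectors), which gets Schmidt number 1. For positive semidefinite X the set of
   values is nonempty, so LEAST is the minimum. *)
definition schmidt_number :: "nat \<Rightarrow> nat \<Rightarrow> complex mat \<Rightarrow> nat" where
  "schmidt_number m n X =
     (LEAST s. \<exists>(r::nat) \<xi>. (\<forall>i<r. \<xi> i \<in> carrier_vec (m * n)) \<and>
        X = mat_sum (m * n) {..<r} (\<lambda>i. rank_one (\<xi> i)) \<and>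
        s = Max (insert 1 ((\<lambda>i. schmidt_rank m n (\<xi> i)) ` {..<r})))"

definition choi_matrix :: "nat \<Rightarrow> nat \<Rightarrow> (complex mat \<Rightarrow> complex mat) \<Rightarrow> complex mat" where
  "choi_matrix d1 d2 \<Phi> =
     mat_sum (d1 * d2) ({..<d1} \<times> {..<d1})
       (\<lambda>(i, j). tensor_mat (mat_unit d1 i j) (\<Phi> (mat_unit d1 i j)))"

definition schmidt_number_map :: "nat \<Rightarrow> nat \<Rightarrow> (complex mat \<Rightarrow> complex mat) \<Rightarrow> nat" where
  "schmidt_number_map d1 d2 \<Phi> = schmidt_number d1 d2 (choi_matrix d1 d2 \<Phi>)"

definition k_partially_entanglement_breaking ::
    "nat \<Rightarrow> nat \<Rightarrow> nat \<Rightarrow> (complex mat \<Rightarrow> complex mat) \<Rightarrow> bool" where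
  "k_partially_entanglement_breaking k d1 d2 \<Phi> \<longleftrightarrow> completely_positive d1 d2 \<Phi> \<and>
     (\<exists>(r::nat) V. (\<forall>i<r. V i \<in> carrier_mat d1 d2 \<and> vec_space.rank d1 (V i) \<le> k) \<and>
        (\<forall>X\<in>carrier_mat d1 d1. \<Phi> X = mat_sum d2 {..<r} (\<lambda>i. mat_adjoint (V i) * X * V i)))"

end

theory Submission
  imports Defs "Jordan_Normal_Form.Spectral_Radius" "HOL-Library.Function_Algebras"
begin

text \<open>
  Conditions (ii), (iii) and (iv) each contain the case of a completely positive \<open>\<Psi>\<close> on the
  \<open>2 \<times> 2\<close> matrices: such a map has Kraus operators with two rows, so it is
  \<open>d2\<close>-partially entanglement breaking because \<open>d2 \<ge> 2\<close>. In this case (i) is only a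
  reformulation. Every positive semidefinite \<open>X\<close> on \<open>\<complex>\<^sup>2 \<otimes> \<complex>\<^bsup>d1\<^esup>\<close> is the Choi matrix of some \<open>\<Psi>\<close>, the
  Choi matrix of \<open>\<Phi> \<circ> \<Psi>\<close> is \<open>(id \<otimes> \<Phi>) X\<close>, Schmidt numbers on \<open>\<complex>\<^sup>2 \<otimes> \<complex>\<^bsup>d1\<^esup>\<close> are at most 2, and
  Schmidt number 1 means separable. Hence for entangled \<open>X\<close> a strict drop of the Schmidt number says
  exactly that \<open>(id \<otimes> \<Phi>) X\<close> is separable, and separable \<open>X\<close> always remain separable.

  The substance is that a completely positive, 2-entanglement breaking \<open>\<Phi>\<close> lowers every Schmidt
  number \<open>k \<ge> 2\<close>, in any dimension (\<open>two_entanglement_breaking_lowers_schmidt_number\<close>). It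
  suffices to treat \<open>X = |\<xi>\<rangle>\<langle>\<xi>|\<close> with \<open>\<xi> = (\<Sum>l<k. a\<^sub>l \<otimes> b\<^sub>l)\<close>. This \<open>X\<close> is the
  image under the local map \<open>e\<^sub>l \<mapsto> a\<^sub>l\<close> of \<open>|\<zeta>\<rangle>\<langle>\<zeta>|\<close> with
  \<open>\<zeta> = (\<Sum>l<k. e\<^sub>l \<otimes> b\<^sub>l)\<close>. Put \<open>Y = (id \<otimes> \<Phi>) |\<zeta>\<rangle>\<langle>\<zeta>|\<close>, which is positive
  semidefinite. The compression of \<open>Y\<close> to the span of \<open>e\<^sub>0, e\<^sub>1\<close> in the first factor is
  \<open>id\<^sub>2 \<otimes> \<Phi>\<close> applied to a positive semidefinite matrix, hence separable: it equals
  \<open>\<Sum>i. |w\<^sub>i\<rangle>\<langle>w\<^sub>i|\<close> with product vectors \<open>w\<^sub>i\<close>. A decomposition of a principal submatrix of a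
  positive semidefinite matrix extends to the whole matrix (\<open>psd_dyads_lift\<close>): \<open>Y\<close> is a sum of
  \<open>|\<eta>\<rangle>\<langle>\<eta>|\<close> where the compression of each \<open>\<eta>\<close> is some \<open>w\<^sub>i\<close> or zero. So the first two
  components of \<open>\<eta>\<close> contribute a single product vector, the other \<open>k - 2\<close> contribute one
  each, and \<open>\<eta>\<close> has tensor rank at most \<open>k - 1\<close>. The local map does not increase it.

  The Schmidt rank is handled as tensor rank, the least number of product vectors that sum to the
  given vector. That the two agree needs the existence of Schmidt decompositions
  (\<open>schmidt_decomposition_exists\<close>), which follows from the spectral theorem, and the independence
  of orthonormal families. The spectral theorem (\<open>psd_has_spectral_form\<close>) is proved for kernels,
  that is, functions of two indices from a finite set. Arbitrary index sets make principal submatrices,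
  tensor products and pairs of indices equally easy to express; the passage to matrices with the
  encoding \<open>(i, a) \<mapsto> i * n + a\<close> is made once.
\<close>

section \<open>Hermitian forms given by kernels on finite index sets\<close>

definition ip :: "'a set \<Rightarrow> ('a \<Rightarrow> complex) \<Rightarrow> ('a \<Rightarrow> complex) \<Rightarrow> complex" where
  "ip S u v = (\<Sum>x\<in>S. cnj (u x) * v x)"

definition app :: "'a set \<Rightarrow> ('a \<Rightarrow> 'a \<Rightarrow> complex) \<Rightarrow> ('a \<Rightarrow> complex) \<Rightarrow> 'a \<Rightarrow> complex" where
  "app S K v x = (\<Sum>y\<in>S. K x y * v y)"

definition psd :: "'a set \<Rightarrow> ('a \<Rightarrow> 'a \<Rightarrow> complex) \<Rightarrow> bool" where
  "psd S K \<longleftrightarrow> (\<forall>c. 0 \<le> ip S c (app S K c))"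

lemma ip_add_right: "ip S u (\<lambda>x. v x + w x) = ip S u v + ip S u w"
  and ip_diff_right: "ip S u (\<lambda>x. v x - w x) = ip S u v - ip S u w"
  and ip_scale_right: "ip S u (\<lambda>x. c * v x) = c * ip S u v"
  and ip_add_left: "ip S (\<lambda>x. v x + w x) u = ip S v u + ip S w u"
  and ip_diff_left: "ip S (\<lambda>x. v x - w x) u = ip S v u - ip S w u"
  and ip_scale_left: "ip S (\<lambda>x. c * v x) u = cnj c * ip S v u"
  by (simp_all add: ip_def algebra_simps sum.distrib sum_subtractf sum_distrib_left)

lemma ip_sum_right: "ip S u (\<lambda>x. \<Sum>i\<in>I. f i x) = (\<Sum>i\<in>I. ip S u (f i))"
  unfolding ip_def sum_distrib_left by (rule sum.swap)

lemma ip_sum_left: "ip S (\<lambda>x. \<Sum>i\<in>I. f i x) u = (\<Sum>i\<in>I. ip S (f i) u)"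
  unfolding ip_def by (simp add: sum_distrib_right) (rule sum.swap)

lemma ip_commute: "ip S v u = cnj (ip S u v)"
  by (simp add: ip_def mult.commute)

lemma ip_cong: "(\<And>x. x \<in> S \<Longrightarrow> u x = u' x) \<Longrightarrow> (\<And>x. x \<in> S \<Longrightarrow> v x = v' x) \<Longrightarrow> ip S u v = ip S u' v'"
  by (simp add: ip_def)

lemma app_cong:
  "(\<And>y. y \<in> S \<Longrightarrow> K x y = L x y) \<Longrightarrow> (\<And>y. y \<in> S \<Longrightarrow> u y = v y) \<Longrightarrow> app S K u x = app S L v x"
  by (simp add: app_def)

lemma psd_cong:
  assumes "\<And>x y. x \<in> S \<Longrightarrow> y \<in> S \<Longrightarrow> K x y = L x y"
  shows "psd S K \<longleftrightarrow> psd S L"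
proof -
  have "ip S c (app S K c) = ip S c (app S L c)" for c
    by (intro ip_cong app_cong) (auto simp: assms)
  then show ?thesis by (simp add: psd_def)
qed

lemma app_add: "app S K (\<lambda>x. u x + v x) = (\<lambda>x. app S K u x + app S K v x)"
  and app_diff: "app S K (\<lambda>x. u x - v x) = (\<lambda>x. app S K u x - app S K v x)"
  and app_scale: "app S K (\<lambda>x. c * u x) = (\<lambda>x. c * app S K u x)"
  by (simp_all add: app_def fun_eq_iff algebra_simps sum.distrib sum_subtractf sum_distrib_left)

lemma ip_mult_ip_nonneg: "0 \<le> ip S u v * ip S v u"
  by (subst (2) ip_commute) (simp add: less_eq_complex_def)

lemma ip_self_nonneg: "0 \<le> ip S u u"
  unfolding ip_def by (intro sum_nonneg) (simp add: less_eq_complex_def)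

lemma ip_self_eq_0:
  assumes "finite S" "ip S u u = 0" "x \<in> S"
  shows "u x = 0"
proof -
  have "\<forall>x\<in>S. cnj (u x) * u x = 0"
    using assms(2) unfolding ip_def
    by (subst (asm) sum_nonneg_eq_0_iff) (auto simp: assms(1) less_eq_complex_def)
  then show ?thesis using assms(3) by simp
qed

definition unit_fun :: "'a \<Rightarrow> 'a \<Rightarrow> complex" where
  "unit_fun a x = (if x = a then 1 else 0)"

lemma ip_unit_left: "finite S \<Longrightarrow> a \<in> S \<Longrightarrow> ip S (unit_fun a) v = v a"
proof -
  assume "finite S" "a \<in> S"
  have "ip S (unit_fun a) v = (\<Sum>x\<in>S. if x = a then v x else 0)"
    unfolding ip_def by (intro sum.cong) (auto simp: unit_fun_def)
  then show ?thesis using \<open>finite S\<close> \<open>a \<in> S\<close> by simp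
qed

lemma app_unit: "finite S \<Longrightarrow> a \<in> S \<Longrightarrow> app S K (unit_fun a) x = K x a"
proof -
  assume "finite S" "a \<in> S"
  have "app S K (unit_fun a) x = (\<Sum>y\<in>S. if y = a then K x y else 0)"
    unfolding app_def by (intro sum.cong) (auto simp: unit_fun_def)
  then show ?thesis using \<open>finite S\<close> \<open>a \<in> S\<close> by simp
qed

text \<open>
  A complex form is determined by its values on the diagonal (polarisation). The diagonal values are real, and
  testing \<open>e\<^sub>x + c e\<^sub>y\<close> with \<open>c = 1\<close> and \<open>c = \<i>\<close> fixes the real and the imaginary part of \<open>K y x\<close>.
\<close>

lemma psd_hermitian:
  assumes fin: "finite S" and K: "psd S K" and xy: "x \<in> S" "y \<in> S"
  shows "K y x = cnj (K x y)"
proof -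
  define dx dy where "dx = unit_fun x" and "dy = unit_fun y"
  have d: "ip S dx (app S K dx) = K x x" "ip S dx (app S K dy) = K x y"
     "ip S dy (app S K dx) = K y x" "ip S dy (app S K dy) = K y y"
    by (simp_all add: dx_def dy_def ip_unit_left app_unit fin xy)
  \<comment> \<open>The form at \<open>e\<^sub>x + c e\<^sub>y\<close>.\<close>
  have q: "ip S (\<lambda>z. dx z + c * dy z) (app S K (\<lambda>z. dx z + c * dy z))
      = K x x + c * K x y + cnj c * K y x + cnj c * c * K y y" for c
    by (simp add: app_add app_scale ip_add_left ip_add_right ip_scale_left ip_scale_right d algebra_simps)
  have im0: "Im (K x x) = 0" "Im (K y y) = 0"
    using K unfolding psd_def d(1)[symmetric] d(4)[symmetric] by (simp_all add: less_eq_complex_def)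
  have im: "Im (K x x + c * K x y + cnj c * K y x + cnj c * c * K y y) = 0" for c
    using K unfolding psd_def q[symmetric] by (metis less_eq_complex_def zero_complex.simps(2))
  show ?thesis
    using im[of 1] im[of \<i>] im0 by (simp add: complex_eq_iff)
qed

lemma ip_app_commute:
  assumes "finite S" "psd S K"
  shows "ip S u (app S K v) = cnj (ip S v (app S K u))"
proof -
  have "ip S u (app S K v) = (\<Sum>x\<in>S. \<Sum>y\<in>S. cnj (u x) * (K x y * v y))"
    by (simp add: ip_def app_def sum_distrib_left)
  also have "\<dots> = (\<Sum>x\<in>S. \<Sum>y\<in>S. cnj (u x) * (cnj (K y x) * v y))"
    by (intro sum.cong refl) (use psd_hermitian[OF assms] in metis)
  also have "\<dots> = (\<Sum>y\<in>S. \<Sum>x\<in>S. cnj (u x) * (cnj (K y x) * v y))"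
    by (rule sum.swap)
  also have "\<dots> = cnj (ip S v (app S K u))"
    by (simp add: ip_def app_def sum_distrib_left algebra_simps)
  finally show ?thesis .
qed

lemma ip_app_dyad:
  assumes "finite I"
  shows "ip S c (app S (\<lambda>x y. \<Sum>i\<in>I. g i x * cnj (h i y)) d) = (\<Sum>i\<in>I. ip S c (g i) * ip S (h i) d)"
proof -
  have "ip S c (app S (\<lambda>x y. \<Sum>i\<in>I. g i x * cnj (h i y)) d)
     = (\<Sum>x\<in>S. \<Sum>y\<in>S. \<Sum>i\<in>I. cnj (c x) * g i x * (cnj (h i y) * d y))"
    by (simp add: ip_def app_def sum_distrib_left sum_distrib_right algebra_simps)
  also have "\<dots> = (\<Sum>x\<in>S. \<Sum>i\<in>I. \<Sum>y\<in>S. cnj (c x) * g i x * (cnj (h i y) * d y))"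
    by (intro sum.cong refl sum.swap)
  also have "\<dots> = (\<Sum>i\<in>I. \<Sum>x\<in>S. \<Sum>y\<in>S. cnj (c x) * g i x * (cnj (h i y) * d y))"
    by (rule sum.swap)
  finally show ?thesis by (simp add: ip_def sum_product)
qed

lemma app_dyad: "app S (\<lambda>x y. \<Sum>i\<in>I. g i x * cnj (h i y)) d x = (\<Sum>i\<in>I. g i x * ip S (h i) d)"
proof -
  have "app S (\<lambda>x y. \<Sum>i\<in>I. g i x * cnj (h i y)) d x = (\<Sum>y\<in>S. \<Sum>i\<in>I. g i x * (cnj (h i y) * d y))"
    by (simp add: app_def sum_distrib_left sum_distrib_right algebra_simps)
  also have "\<dots> = (\<Sum>i\<in>I. \<Sum>y\<in>S. g i x * (cnj (h i y) * d y))" by (rule sum.swap)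
  finally show ?thesis by (simp add: ip_def sum_distrib_left)
qed

definition orthonormal :: "'a set \<Rightarrow> 'i set \<Rightarrow> ('i \<Rightarrow> 'a \<Rightarrow> complex) \<Rightarrow> bool" where
  "orthonormal S I u \<longleftrightarrow> (\<forall>i\<in>I. \<forall>j\<in>I. ip S (u i) (u j) = (if i = j then 1 else 0))"

definition has_spectral_form :: "'a set \<Rightarrow> ('a \<Rightarrow> 'a \<Rightarrow> complex) \<Rightarrow> bool" where
  "has_spectral_form S K \<longleftrightarrow> (\<exists>(r::nat) l u. (\<forall>i<r. 0 < (l i :: real)) \<and> orthonormal S {..<r} u \<and>
     (\<forall>x\<in>S. \<forall>y\<in>S. K x y = (\<Sum>i<r. complex_of_real (l i) * (u i x * cnj (u i y)))))"

text \<open>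
  The index set is enumerated so that the existence of eigenvalues of complex matrices applies.
\<close>

lemma eigenvector_exists:
  assumes fin: "finite S" and ne: "S \<noteq> {}"
  shows "\<exists>u c. (\<forall>x\<in>S. app S K u x = c * u x) \<and> ip S u u = 1"
proof -
  obtain h where h: "bij_betw h {0..<card S} S"
    using ex_bij_betw_nat_finite[OF fin] by blast
  define n where "n = card S"
  have n: "n > 0" using fin ne by (simp add: n_def card_gt_0_iff)
  define A where "A = mat n n (\<lambda>(i, j). K (h i) (h j))"
  have A: "A \<in> carrier_mat n n" by (simp add: A_def)
  obtain c where "eigenvalue A c"
    using spectrum_non_empty[OF A n] by (auto simp: spectrum_def)
  then obtain v where v: "v \<in> carrier_vec n" "v \<noteq> 0\<^sub>v n" and ev: "A *\<^sub>v v = c \<cdot>\<^sub>v v"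
    using A by (auto simp: eigenvalue_def eigenvector_def)
  define w where "w x = v $ (the_inv_into {0..<n} h x)" for x
  have wh: "w (h i) = v $ i" if "i < n" for i
    using h that by (simp add: w_def n_def bij_betw_def the_inv_into_f_f)
  have hS: "(\<Sum>y\<in>S. f y) = (\<Sum>i = 0..<n. f (h i))" for f :: "'a \<Rightarrow> complex"
    using sum.reindex_bij_betw[OF h, of f] by (simp add: n_def)
  have eig: "app S K w x = c * w x" if "x \<in> S" for x
  proof -
    obtain i where i: "i < n" "x = h i"
      using h \<open>x \<in> S\<close> by (force simp: n_def bij_betw_def)
    have "app S K w x = (\<Sum>j = 0..<n. A $$ (i, j) * v $ j)"
      unfolding app_def hS by (intro sum.cong refl) (simp add: wh A_def i)
    also have "\<dots> = (A *\<^sub>v v) $ i"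
      using A v i by (simp add: scalar_prod_def)
    also have "\<dots> = c * w x"
      using ev v i by (simp add: wh)
    finally show ?thesis .
  qed
  have "ip S w w \<noteq> 0"
  proof
    assume "ip S w w = 0"
    then have "w x = 0" if "x \<in> S" for x
      using ip_self_eq_0[OF fin _ that] by blast
    moreover have "h i \<in> S" if "i < n" for i
      using h that by (auto simp: n_def bij_betw_def)
    ultimately have "v $ i = 0" if "i < n" for i
      using wh[OF that] that by metis
    then show False using v by (metis eq_vecI carrier_vecD index_zero_vec)
  qed
  then have pos: "Re (ip S w w) > 0" and im: "Im (ip S w w) = 0"
    using ip_self_nonneg[of S w] by (auto simp: less_eq_complex_def complex_eq_iff)
  define s where "s = complex_of_real (1 / sqrt (Re (ip S w w)))"
  have ss: "cnj s * s * ip S w w = 1"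
    using pos im by (simp add: s_def complex_eq_iff flip: of_real_mult)
  show ?thesis
  proof (intro exI conjI ballI)
    fix x assume "x \<in> S"
    then show "app S K (\<lambda>x. s * w x) x = c * (s * w x)"
      by (simp add: app_scale eig)
  next
    show "ip S (\<lambda>x. s * w x) (\<lambda>x. s * w x) = 1"
      using ss by (simp add: ip_scale_left ip_scale_right algebra_simps)
  qed
qed

section \<open>The spectral theorem for positive semidefinite kernels\<close>

lemma app_sum: "app S K (\<lambda>x. \<Sum>i\<in>I. f i x) = (\<lambda>x. \<Sum>i\<in>I. app S K (f i) x)"
  unfolding app_def sum_distrib_left by (rule ext, rule sum.swap)

text \<open>
  The Householder reflection in the hyperplane orthogonal to \<open>w\<close>.
\<close>

definition reflect :: "'a set \<Rightarrow> ('a \<Rightarrow> complex) \<Rightarrow> ('a \<Rightarrow> complex) \<Rightarrow> 'a \<Rightarrow> complex" where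
  "reflect S w v x = v x - 2 * ip S w v / ip S w w * w x"

lemma reflect_adjoint: "ip S (reflect S w u) v = ip S u (reflect S w v)"
proof -
  have c: "cnj (ip S w w) = ip S w w" "cnj (ip S w u) = ip S u w"
    using ip_commute by metis+
  show ?thesis
    unfolding reflect_def ip_diff_left ip_diff_right ip_scale_left ip_scale_right
    by (simp add: c)
qed

lemma reflect_involution:
  assumes "ip S w w \<noteq> 0"
  shows "reflect S w (reflect S w v) = v"
proof
  fix x
  have "ip S w (reflect S w v) = - ip S w v"
    unfolding reflect_def ip_diff_right ip_scale_right using assms by simp
  then show "reflect S w (reflect S w v) x = v x"
    by (subst reflect_def) (simp add: reflect_def)
qed

text \<open>
  The reflection that exchanges a unit vector with the coordinate vector at \<open>x0\<close> is unitary, so it maps the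
  coordinate basis to an orthonormal basis that contains the unit vector. This works as soon as the
  component at \<open>x0\<close> is real and not 1, which a phase \<open>p\<close> achieves by making it nonpositive.
\<close>

lemma unit_vector_extends_to_basis:
  assumes fin: "finite S" and x0: "x0 \<in> S" and u: "ip S u u = 1"
  shows "\<exists>b p. orthonormal S S b \<and> (\<forall>x. b x0 x = p * u x) \<and>
    (\<forall>v. \<forall>x\<in>S. v x = (\<Sum>a\<in>S. ip S (b a) v * b a x))"
proof -
  define p where "p = (if u x0 = 0 then 1 else - cnj (u x0) / complex_of_real (cmod (u x0)))"
  have "cnj (u x0) * u x0 = complex_of_real (cmod (u x0)) * complex_of_real (cmod (u x0))"
    using complex_norm_square[of "u x0"] by (simp add: power2_eq_square mult.commute)
  then have pp: "p * cnj p = 1"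
    by (simp add: p_def)
  have pu: "p * u x0 = - complex_of_real (cmod (u x0))"
    by (simp add: p_def complex_norm_square[symmetric] power2_eq_square mult.commute[of "cnj (u x0)"])
  define t where "t = cmod (u x0)"
  define u' where "u' = (\<lambda>x. p * u x)"
  define w where "w = (\<lambda>x. u' x - unit_fun x0 x)"
  have u'u': "ip S u' u' = 1"
    using pp by (simp add: u'_def ip_scale_left ip_scale_right u mult.commute)
  have ee: "ip S (unit_fun a) (unit_fun a') = (if a = a' then 1 else 0)" if "a \<in> S" for a a' :: 'a
    by (simp add: ip_unit_left[OF fin that] unit_fun_def)
  have eu: "ip S (unit_fun x0) u' = - complex_of_real t"
    by (simp add: ip_unit_left[OF fin x0] u'_def pu t_def)
  have ue: "ip S u' (unit_fun x0) = - complex_of_real t"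
    by (subst ip_commute) (simp add: eu)
  have wu: "ip S w u' = 1 + complex_of_real t"
    unfolding w_def ip_diff_left by (simp add: u'u' eu)
  have we: "ip S w (unit_fun x0) = - (1 + complex_of_real t)"
    unfolding w_def ip_diff_left by (simp add: ue ee[OF x0])
  have ww: "ip S w w = 2 * (1 + complex_of_real t)"
  proof -
    have "ip S w w = ip S w u' - ip S w (unit_fun x0)"
      by (subst (2) w_def) (rule ip_diff_right)
    then show ?thesis by (simp add: wu we)
  qed
  have t1: "1 + complex_of_real t \<noteq> 0"
  proof
    assume "1 + complex_of_real t = 0"
    then have "1 + t = 0" by (metis of_real_1 of_real_add of_real_eq_0_iff)
    then show False using norm_ge_zero[of "u x0"] by (simp add: t_def)
  qed
  have w0: "ip S w w \<noteq> 0" unfolding ww using t1 by (metis mult_eq_0_iff zero_neq_numeral)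
  define b where "b = (\<lambda>a. reflect S w (unit_fun a))"
  have "2 * - q / (2 * q) = -1" if "q \<noteq> 0" for q :: complex
    using that by simp
  then have "2 * ip S w (unit_fun x0) / ip S w w = -1"
    unfolding we ww using t1 by blast
  then have bx0: "b x0 x = p * u x" for x
    by (simp add: b_def reflect_def) (simp add: w_def u'_def)
  have on: "orthonormal S S b"
    unfolding orthonormal_def b_def
    by (simp add: reflect_adjoint reflect_involution[OF w0] ee)
  have expand: "v x = (\<Sum>a\<in>S. ip S (b a) v * b a x)" if "x \<in> S" for v x
  proof -
    define r where "r = reflect S w v"
    have ra: "ip S (b a) v = r a" if "a \<in> S" for a
      by (simp add: r_def b_def reflect_adjoint ip_unit_left[OF fin that])
    have ba: "b a x = unit_fun a x - (2 / ip S w w * w x) * ip S w (unit_fun a)" for a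
      by (simp add: b_def reflect_def)
    have "(\<Sum>a\<in>S. ip S (b a) v * b a x) = (\<Sum>a\<in>S. r a * unit_fun a x - (2 / ip S w w * w x) * (ip S w (unit_fun a) * r a))"
      by (intro sum.cong refl) (simp add: ra ba algebra_simps)
    also have "\<dots> = (\<Sum>a\<in>S. r a * unit_fun a x) - (2 / ip S w w * w x) * (\<Sum>a\<in>S. ip S w (unit_fun a) * r a)"
      by (simp add: sum_subtractf sum_distrib_left)
    also have "(\<Sum>a\<in>S. r a * unit_fun a x) = r x"
    proof -
      have "(\<Sum>a\<in>S. r a * unit_fun a x) = (\<Sum>a\<in>S. if a = x then r a else 0)"
        by (intro sum.cong) (auto simp: unit_fun_def)
      then show ?thesis using fin that by simp
    qed
    also have "(\<Sum>a\<in>S. ip S w (unit_fun a) * r a) = ip S w r"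
    proof -
      have "ip S w (unit_fun a) = cnj (w a)" if "a \<in> S" for a
        using ip_commute[of S w "unit_fun a"] ip_unit_left[OF fin that] by simp
      then show ?thesis unfolding ip_def[of S w r] by (intro sum.cong) auto
    qed
    also have "r x - 2 / ip S w w * w x * ip S w r = reflect S w r x"
      by (simp add: reflect_def[of S w r])
    finally show ?thesis by (simp add: r_def reflect_involution[OF w0])
  qed
  show ?thesis
    by (intro exI[of _ b] exI[of _ p] conjI on allI ballI bx0 expand)
qed

text \<open>
  Induction on the index set. An eigenvector extends to an orthonormal basis, in which the kernel is block
  diagonal because its matrix is Hermitian. The induction hypothesis diagonalises the smaller block. Only positive
  eigenvalues are kept, so that one may divide by them.
\<close>

theorem psd_has_spectral_form:
  assumes "finite S" "psd S K"
  shows "has_spectral_form S K"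
  using assms
proof (induction S arbitrary: K rule: finite_induct)
  case empty
  show ?case
    unfolding has_spectral_form_def by (rule exI[of _ 0]) (simp add: orthonormal_def)
next
  case (insert x0 S' K)
  define S where "S = insert x0 S'"
  have fin: "finite S" and x0: "x0 \<in> S" and psd: "psd S K" and S'S: "\<And>a. a \<in> S' \<Longrightarrow> a \<in> S"
    using insert by (auto simp: S_def)
  obtain u c where eig: "\<And>x. x \<in> S \<Longrightarrow> app S K u x = c * u x" and u1: "ip S u u = 1"
    using eigenvector_exists[OF fin, of K] x0 by blast
  obtain b p where on: "orthonormal S S b" and bx0: "\<And>x. b x0 x = p * u x"
    and expand: "\<And>v x. x \<in> S \<Longrightarrow> v x = (\<Sum>a\<in>S. ip S (b a) v * b a x)"
    using unit_vector_extends_to_basis[OF fin x0 u1] by blast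
  have onD: "ip S (b a) (b a') = (if a = a' then 1 else 0)" if "a \<in> S" "a' \<in> S" for a a'
    using on that by (simp add: orthonormal_def)
  \<comment> \<open>The matrix of \<open>K\<close> in the new basis.\<close>
  define M where "M a a' = ip S (b a) (app S K (b a'))" for a a'
  have M_herm: "M a a' = cnj (M a' a)" for a a'
    unfolding M_def by (rule ip_app_commute[OF fin psd])
  have "b x0 = (\<lambda>x. p * u x)" using bx0 by auto
  then have eigb: "app S K (b x0) x = c * b x0 x" if "x \<in> S" for x
    using eig[OF that] by (simp add: app_scale)
  have Mx0: "M a x0 = c * (if a = x0 then 1 else 0)" if "a \<in> S" for a
  proof -
    have "M a x0 = ip S (b a) (\<lambda>x. c * b x0 x)"
      unfolding M_def by (rule ip_cong) (simp_all add: eigb)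
    then show ?thesis by (simp add: ip_scale_right onD[OF that x0])
  qed
  have M0: "M a x0 = 0" "M x0 a = 0" if "a \<in> S'" for a
  proof -
    show "M a x0 = 0" using Mx0[OF S'S[OF that]] that insert.hyps by auto
    then show "M x0 a = 0" by (subst M_herm) simp
  qed
  have K: "K x y = (\<Sum>a\<in>S. \<Sum>a'\<in>S. M a a' * (b a x * cnj (b a' y)))" if xy: "x \<in> S" "y \<in> S" for x y
  proof -
    have "K x y = app S K (unit_fun y) x"
      by (simp add: app_unit[OF fin xy(2)])
    also have "\<dots> = (\<Sum>a\<in>S. ip S (b a) (app S K (unit_fun y)) * b a x)"
      by (rule expand[OF xy(1)])
    also have "\<dots> = (\<Sum>a\<in>S. \<Sum>a'\<in>S. M a a' * (b a x * cnj (b a' y)))"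
    proof (rule sum.cong[OF refl])
      fix a
      have "ip S (b a) (app S K (unit_fun y)) = cnj (app S K (b a) y)"
        by (subst ip_app_commute[OF fin psd]) (simp add: ip_unit_left[OF fin xy(2)])
      also have "app S K (b a) y = (\<Sum>a'\<in>S. M a' a * b a' y)"
        unfolding M_def by (rule expand[OF xy(2)])
      also have "cnj \<dots> = (\<Sum>a'\<in>S. M a a' * cnj (b a' y))"
        by (simp add: M_herm[of a])
      finally show "ip S (b a) (app S K (unit_fun y)) * b a x = (\<Sum>a'\<in>S. M a a' * (b a x * cnj (b a' y)))"
        by (simp add: sum_distrib_left sum_distrib_right algebra_simps)
    qed
    finally show ?thesis .
  qed
  \<comment> \<open>Coordinates on \<open>S'\<close> become vectors orthogonal to the eigenvector, isometrically.\<close>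
  define lc where "lc v = (\<lambda>x. \<Sum>a\<in>S'. v a * b a x)" for v
  have ip_lc: "ip S (lc v) h = (\<Sum>a\<in>S'. cnj (v a) * ip S (b a) h)" for v h
    unfolding lc_def by (simp add: ip_sum_left ip_scale_left)
  have ip_lc2: "ip S h (lc v) = (\<Sum>a\<in>S'. v a * ip S h (b a))" for v h
    unfolding lc_def by (simp add: ip_sum_right ip_scale_right)
  have app_lc: "app S K (lc v) = (\<lambda>x. \<Sum>a\<in>S'. v a * app S K (b a) x)" for v
    by (simp add: lc_def app_sum app_scale)
  have "psd S' M"
    unfolding psd_def
  proof
    fix d
    have "ip S' d (app S' M d) = (\<Sum>a\<in>S'. cnj (d a) * (\<Sum>a'\<in>S'. d a' * M a a'))"
      by (simp add: ip_def app_def mult.commute)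
    also have "\<dots> = ip S (lc d) (app S K (lc d))"
      by (subst ip_lc) (simp add: M_def app_lc ip_sum_right ip_scale_right)
    finally show "0 \<le> ip S' d (app S' M d)"
      using psd by (simp add: psd_def)
  qed
  then have "has_spectral_form S' M" by (rule insert.IH)
  then obtain r :: nat and l v where l: "\<And>i. i < r \<Longrightarrow> 0 < (l i :: real)" and onv: "orthonormal S' {..<r} v"
    and M: "\<And>a a'. a \<in> S' \<Longrightarrow> a' \<in> S' \<Longrightarrow> M a a' = (\<Sum>i<r. complex_of_real (l i) * (v i a * cnj (v i a')))"
    unfolding has_spectral_form_def by blast
  have lc_on: "ip S (lc (v i)) (lc (v j)) = (if i = j then 1 else 0)" if "i < r" "j < r" for i j
  proof -
    have "ip S (lc (v i)) (lc (v j)) = (\<Sum>a\<in>S'. cnj (v i a) * (\<Sum>a'\<in>S'. v j a' * ip S (b a) (b a')))"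
      by (subst ip_lc) (simp add: ip_lc2)
    also have "\<dots> = (\<Sum>a\<in>S'. cnj (v i a) * (\<Sum>a'\<in>S'. if a' = a then v j a' else 0))"
      by (intro sum.cong refl arg_cong2[of _ _ _ _ "(*)"]) (auto simp: onD S'S)
    also have "\<dots> = ip S' (v i) (v j)"
      using insert.hyps by (simp add: ip_def)
    finally show ?thesis using onv that by (simp add: orthonormal_def)
  qed
  have lc_x0: "ip S (b x0) (lc (v i)) = 0" for i
  proof -
    have "ip S (b x0) (b a) = 0" if "a \<in> S'" for a
      using onD[OF x0 S'S[OF that]] that insert.hyps by auto
    then show ?thesis by (simp add: ip_lc2)
  qed
  then have lc_x0': "ip S (lc (v i)) (b x0) = 0" for i
    by (subst ip_commute) simp
  have K2: "K x y = M x0 x0 * (b x0 x * cnj (b x0 y))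
      + (\<Sum>i<r. complex_of_real (l i) * (lc (v i) x * cnj (lc (v i) y)))" if xy: "x \<in> S" "y \<in> S" for x y
  proof -
    have "K x y = M x0 x0 * (b x0 x * cnj (b x0 y)) + (\<Sum>a\<in>S'. \<Sum>a'\<in>S'. M a a' * (b a x * cnj (b a' y)))"
      unfolding K[OF xy] S_def using insert.hyps by (simp add: M0)
    also have "(\<Sum>a\<in>S'. \<Sum>a'\<in>S'. M a a' * (b a x * cnj (b a' y)))
      = (\<Sum>a\<in>S'. \<Sum>a'\<in>S'. \<Sum>i<r. complex_of_real (l i) * ((v i a * b a x) * (cnj (v i a' * b a' y))))"
      by (intro sum.cong refl) (simp add: M sum_distrib_left sum_distrib_right algebra_simps)
    also have "\<dots> = (\<Sum>a\<in>S'. \<Sum>i<r. \<Sum>a'\<in>S'. complex_of_real (l i) * ((v i a * b a x) * (cnj (v i a' * b a' y))))"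
      by (intro sum.cong refl sum.swap)
    also have "\<dots> = (\<Sum>i<r. \<Sum>a\<in>S'. \<Sum>a'\<in>S'. complex_of_real (l i) * ((v i a * b a x) * (cnj (v i a' * b a' y))))"
      by (rule sum.swap)
    also have "\<dots> = (\<Sum>i<r. complex_of_real (l i) * (lc (v i) x * cnj (lc (v i) y)))"
      by (simp only: lc_def cnj_sum sum_product) (simp only: sum_distrib_left)
    finally show ?thesis .
  qed
  have "0 \<le> M x0 x0" using psd by (simp add: M_def psd_def)
  then obtain m where m: "M x0 x0 = complex_of_real m" "0 \<le> m"
    by (auto simp: less_eq_complex_def complex_eq_iff intro: that[of "Re (M x0 x0)"])
  show ?case
  proof (cases "m = 0")
    case True
    then show ?thesis
      unfolding has_spectral_form_def S_def[symmetric]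
      by (intro exI[of _ r] exI[of _ l] exI[of _ "\<lambda>i. lc (v i)"])
         (simp add: l orthonormal_def lc_on K2 m)
  next
    case False
    define l' where "l' i = (if i < r then l i else m)" for i
    define v' where "v' i = (if i < r then lc (v i) else b x0)" for i
    have "orthonormal S {..<Suc r} v'"
      using onD[OF x0 x0] by (auto simp: orthonormal_def v'_def lc_on lc_x0 lc_x0')
    moreover have "\<forall>i<Suc r. 0 < l' i"
      using l m False by (auto simp: l'_def)
    moreover have "\<forall>x\<in>S. \<forall>y\<in>S. K x y = (\<Sum>i<Suc r. complex_of_real (l' i) * (v' i x * cnj (v' i y)))"
      by (simp add: K2 m l'_def v'_def)
    ultimately show ?thesis
      unfolding has_spectral_form_def S_def[symmetric] by blast
  qed
qed

section \<open>Decompositions into rank-one kernels and their extension\<close>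

text \<open>
  The sum of \<open>|f\<rangle>\<langle>f|\<close>. Lists rather than sets, because repeated vectors count and because
  decompositions are joined and multiplied.
\<close>

definition dyads :: "('a \<Rightarrow> complex) list \<Rightarrow> 'a \<Rightarrow> 'a \<Rightarrow> complex" where
  "dyads F x y = (\<Sum>f\<leftarrow>F. f x * cnj (f y))"

lemma dyads_simps [simp]:
  "dyads [] x y = 0" "dyads (f # F) x y = f x * cnj (f y) + dyads F x y"
  "dyads (F @ G) x y = dyads F x y + dyads G x y"
  by (simp_all add: dyads_def)

lemma ip_app_dyads: "ip S c (app S (dyads F) d) = (\<Sum>f\<leftarrow>F. ip S c f * ip S f d)"
proof -
  have "dyads F = (\<lambda>x y. \<Sum>i<length F. (F ! i) x * cnj ((F ! i) y))"
    by (simp add: dyads_def fun_eq_iff sum_list_sum_nth atLeast0LessThan)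
  then show ?thesis
    by (simp add: ip_app_dyad sum_list_sum_nth atLeast0LessThan)
qed

lemma sum_list_mult_cnj_nonneg: "0 \<le> (\<Sum>x\<leftarrow>xs. g x * cnj (g x))"
  by (intro sum_list_nonneg) (auto simp: less_eq_complex_def)

lemma psd_dyads: "psd S (dyads F)"
proof -
  have "ip S c (app S (dyads F) c) = (\<Sum>f\<leftarrow>F. ip S c f * cnj (ip S c f))" for c
    unfolding ip_app_dyads by (subst (2) ip_commute) simp
  then show ?thesis by (simp add: psd_def sum_list_mult_cnj_nonneg)
qed

lemma sum_list_mult_cnj_eq_0D:
  "(\<Sum>x\<leftarrow>xs. g x * cnj (g x)) = (0::complex) \<Longrightarrow> x \<in> set xs \<Longrightarrow> g x = 0"
proof (induction xs)
  case (Cons y ys)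
  have "0 \<le> g y * cnj (g y)"
    by (simp add: less_eq_complex_def)
  moreover have "0 \<le> (\<Sum>x\<leftarrow>ys. g x * cnj (g x))"
    by (rule sum_list_mult_cnj_nonneg)
  ultimately have "g y * cnj (g y) = 0" "(\<Sum>x\<leftarrow>ys. g x * cnj (g x)) = 0"
    using Cons.prems(1) by (simp_all add: add_nonneg_eq_0_iff)
  then show ?case using Cons by auto
qed simp

lemma psd_imp_dyads:
  assumes "finite S" "psd S K"
  shows "\<exists>F. \<forall>x\<in>S. \<forall>y\<in>S. K x y = dyads F x y"
proof -
  obtain r :: nat and l u where l: "\<And>i. i < r \<Longrightarrow> 0 < (l i :: real)"
    and K: "\<And>x y. x \<in> S \<Longrightarrow> y \<in> S \<Longrightarrow> K x y = (\<Sum>i<r. complex_of_real (l i) * (u i x * cnj (u i y)))"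
    using psd_has_spectral_form[OF assms] unfolding has_spectral_form_def by blast
  define F where "F = map (\<lambda>i x. complex_of_real (sqrt (l i)) * u i x) [0..<r]"
  have "K x y = dyads F x y" if "x \<in> S" "y \<in> S" for x y
  proof -
    have "complex_of_real (l i) = complex_of_real (sqrt (l i)) * complex_of_real (sqrt (l i))" if "i < r" for i
      using l[OF that] by (simp flip: of_real_mult)
    then have "complex_of_real (l i) * (u i x * cnj (u i y))
        = (complex_of_real (sqrt (l i)) * u i x) * cnj (complex_of_real (sqrt (l i)) * u i y)" if "i < r" for i
      using that by (simp add: algebra_simps)
    then have "(\<Sum>i<r. complex_of_real (l i) * (u i x * cnj (u i y)))
        = (\<Sum>i<r. (complex_of_real (sqrt (l i)) * u i x) * cnj (complex_of_real (sqrt (l i)) * u i y))"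
      by (intro sum.cong) auto
    then show ?thesis
      by (simp add: K[OF that] dyads_def F_def sum_list_sum_nth atLeast0LessThan)
  qed
  then show ?thesis by blast
qed

text \<open>
  The hypothesis says that \<open>w\<close> is orthogonal to the null vectors of the form. With an orthonormal
  family \<open>u\<^sub>i\<close> of eigenvectors for the nonzero eigenvalues, the part of \<open>w\<close> orthogonal to all \<open>u\<^sub>i\<close> is a
  null vector, hence orthogonal to \<open>w\<close> and zero. On the span of the \<open>u\<^sub>i\<close> the kernel is inverted by dividing by
  the eigenvalues.
\<close>

lemma psd_range:
  assumes fin: "finite S" and K: "psd S K"
    and w: "\<And>v. ip S v (app S K v) = 0 \<Longrightarrow> ip S v w = 0"
  shows "\<exists>z. \<forall>x\<in>S. app S K z x = w x"
proof -
  obtain r :: nat and l u where l: "\<And>i. i < r \<Longrightarrow> 0 < (l i :: real)" and on: "orthonormal S {..<r} u"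
    and K: "\<And>x y. x \<in> S \<Longrightarrow> y \<in> S \<Longrightarrow> K x y = (\<Sum>i<r. complex_of_real (l i) * (u i x * cnj (u i y)))"
    using psd_has_spectral_form[OF fin K] unfolding has_spectral_form_def by blast
  have app_K: "app S K d x = (\<Sum>i<r. complex_of_real (l i) * u i x * ip S (u i) d)" if "x \<in> S" for d x
  proof -
    have "app S K d x = app S (\<lambda>x y. \<Sum>i<r. (complex_of_real (l i) * u i x) * cnj (u i y)) d x"
      by (rule app_cong) (simp_all add: K that algebra_simps)
    then show ?thesis by (simp add: app_dyad)
  qed
  have ip_u: "ip S (u j) (\<lambda>x. \<Sum>i<r. c i * u i x) = c j" if "j < r" for c j
  proof -
    have "ip S (u j) (\<lambda>x. \<Sum>i<r. c i * u i x) = (\<Sum>i<r. if i = j then c i else 0)"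
      unfolding ip_sum_right ip_scale_right
      by (intro sum.cong refl) (use on that in \<open>auto simp: orthonormal_def\<close>)
    then show ?thesis using that by simp
  qed
  \<comment> \<open>The orthogonal projection of \<open>w\<close> to the range, and the rest.\<close>
  define p where "p = (\<lambda>x. \<Sum>i<r. ip S (u i) w * u i x)"
  define v where "v = (\<lambda>x. w x - p x)"
  have uv: "ip S (u j) v = 0" if "j < r" for j
    unfolding v_def ip_diff_right p_def by (simp add: ip_u[OF that])
  have "ip S v (app S K v) = ip S v (\<lambda>_. 0)"
    by (rule ip_cong) (simp_all add: app_K uv)
  then have "ip S v w = 0" by (intro w) (simp add: ip_def)
  moreover have "ip S v p = 0"
    unfolding p_def ip_sum_right ip_scale_right
    by (intro sum.neutral ballI) (subst ip_commute, simp add: uv)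
  ultimately have "ip S v v = 0"
    by (subst (2) v_def) (simp add: ip_diff_right)
  then have wp: "w x = p x" if "x \<in> S" for x
    using ip_self_eq_0[OF fin _ that, of v] by (simp add: v_def)
  define z where "z = (\<lambda>x. \<Sum>i<r. (ip S (u i) w / complex_of_real (l i)) * u i x)"
  have uz: "ip S (u i) z = ip S (u i) w / complex_of_real (l i)" if "i < r" for i
    unfolding z_def by (rule ip_u[OF that])
  have "app S K z x = w x" if "x \<in> S" for x
  proof -
    have "app S K z x = p x"
      unfolding app_K[OF that] p_def
    proof (rule sum.cong[OF refl])
      fix i assume "i \<in> {..<r}"
      then show "complex_of_real (l i) * u i x * ip S (u i) z = ip S (u i) w * u i x"
        using uz[of i] l[of i] by simp
    qed
    then show ?thesis using wp[OF that] by simp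
  qed
  then show ?thesis by blast
qed

text \<open>
  The vectors of
  \<open>W\<close> are split off one at a time. Since \<open>|w\<rangle>\<langle>w|\<close> lies below \<open>K\<close> on \<open>T\<close>, there is \<open>z\<close>
  supported in \<open>T\<close> with \<open>K z = w\<close> on \<open>T\<close>. Then \<open>\<xi> = K z\<close> extends \<open>w\<close>, and
  \<open>K - |\<xi>\<rangle>\<langle>\<xi>|\<close> is still positive semidefinite because \<open>\<langle>z, K z\<rangle> \<le> 1\<close>. When
  nothing is left on \<open>T\<close>, every decomposition of the remainder vanishes there.
\<close>

theorem psd_dyads_lift:
  assumes fin: "finite S" and TS: "T \<subseteq> S" and K: "psd S K"
    and KW: "\<And>x y. x \<in> T \<Longrightarrow> y \<in> T \<Longrightarrow> K x y = dyads W x y"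
  shows "\<exists>F. (\<forall>x\<in>S. \<forall>y\<in>S. K x y = dyads F x y) \<and>
    (\<forall>f\<in>set F. (\<forall>x\<in>T. f x = 0) \<or> (\<exists>w\<in>set W. \<forall>x\<in>T. f x = w x))"
  using K KW
proof (induction W arbitrary: K)
  case Nil
  obtain F where F: "\<And>x y. x \<in> S \<Longrightarrow> y \<in> S \<Longrightarrow> K x y = dyads F x y"
    using psd_imp_dyads[OF fin Nil(1)] by blast
  have "f x = 0" if "f \<in> set F" "x \<in> T" for f x
  proof -
    have "(\<Sum>f\<leftarrow>F. f x * cnj (f x)) = 0"
      using F[of x x] Nil(2)[of x x] that TS by (auto simp: dyads_def)
    then show ?thesis
      using sum_list_mult_cnj_eq_0D[of "\<lambda>f. f x" F f] that by simp
  qed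
  with F show ?case by blast
next
  case (Cons w W)
  have finT: "finite T" using TS fin by (rule finite_subset)
  have appT: "app T K d x = app T (dyads (w # W)) d x" if "x \<in> T" for d x
    by (rule app_cong) (use Cons.prems(2) that in auto)
  have qT: "ip T c (app T K c) = ip T c w * cnj (ip T c w) + (\<Sum>f\<leftarrow>W. ip T c f * cnj (ip T c f))" for c
  proof -
    have "ip T c (app T K c) = ip T c (app T (dyads (w # W)) c)"
      by (rule ip_cong) (simp_all add: appT del: dyads_simps)
    also have "\<dots> = (\<Sum>f\<leftarrow>w # W. ip T c f * cnj (ip T c f))"
      unfolding ip_app_dyads by (subst (2) ip_commute) simp
    finally show ?thesis by simp
  qed
  have psdT: "psd T K"
    unfolding psd_def qT
    using sum_list_mult_cnj_nonneg[of _ "w # W"] by simp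
  obtain z where z: "\<And>x. x \<in> T \<Longrightarrow> app T K z x = w x"
  proof -
    have "ip T v w = 0" if "ip T v (app T K v) = 0" for v
      using sum_list_mult_cnj_eq_0D[of "\<lambda>f. ip T v f" "w # W" w] that unfolding qT by simp
    then show ?thesis using psd_range[OF finT psdT, of w] that by blast
  qed
  define z' where "z' = (\<lambda>x. if x \<in> T then z x else 0)"
  define \<xi> where "\<xi> = app S K z'"
  have ST: "(\<Sum>x\<in>S. if x \<in> T then g x else 0) = (\<Sum>x\<in>T. g x)" for g :: "'a \<Rightarrow> complex"
    using TS fin by (simp add: sum.If_cases Int_absorb1)
  have xi: "\<xi> x = w x" if "x \<in> T" for x
  proof -
    have "\<xi> x = (\<Sum>y\<in>S. if y \<in> T then K x y * z y else 0)"
      unfolding \<xi>_def app_def by (intro sum.cong) (auto simp: z'_def)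
    then show ?thesis using z[OF that] by (simp add: ST app_def)
  qed
  define t where "t = ip S z' \<xi>"
  have t: "t = ip T z w"
  proof -
    have "t = (\<Sum>x\<in>S. if x \<in> T then cnj (z x) * w x else 0)"
      unfolding t_def ip_def by (intro sum.cong) (auto simp: z'_def xi)
    then show ?thesis by (simp add: ST ip_def)
  qed
  have t0: "0 \<le> t"
    using Cons.prems(1) by (simp add: t_def \<xi>_def psd_def)
  \<comment> \<open>On \<open>T\<close> the form at \<open>z\<close> is \<open>t\<close>, and its summand from \<open>w\<close> alone is \<open>|t|\<^sup>2\<close>; so \<open>t \<le> 1\<close>.\<close>
  have "t * cnj t \<le> t"
  proof -
    have "ip T z w = ip T z (app T K z)" by (rule ip_cong) (simp_all add: z)
    then have e: "t = t * cnj t + (\<Sum>f\<leftarrow>W. ip T z f * cnj (ip T z f))"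
      unfolding t using qT[of z] by metis
    have "t * cnj t + 0 \<le> t * cnj t + (\<Sum>f\<leftarrow>W. ip T z f * cnj (ip T z f))"
      by (intro add_left_mono sum_list_mult_cnj_nonneg)
    then show ?thesis
      using e by (metis add.right_neutral)
  qed
  then have tt: "Re (t * cnj t) \<le> Re t"
    unfolding less_eq_complex_def by blast
  have t1: "Im t = 0" "0 \<le> Re t"
    using t0 by (simp_all add: less_eq_complex_def)
  have t2: "Re t \<le> 1"
  proof (rule ccontr)
    assume "\<not> Re t \<le> 1"
    then have "Re t * 1 < Re t * Re t" by (intro mult_strict_left_mono) auto
    then show False using tt t1 by simp
  qed
  define K' where "K' = (\<lambda>x y. K x y - \<xi> x * cnj (\<xi> y))"
  have "psd S K'"
    unfolding psd_def
  proof
    fix c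
    define \<alpha> where "\<alpha> = ip S z' (app S K c)"
    have a1: "ip S c \<xi> = cnj \<alpha>"
      unfolding \<xi>_def \<alpha>_def by (rule ip_app_commute[OF fin Cons.prems(1)])
    then have a2: "ip S \<xi> c = \<alpha>"
      by (subst ip_commute) simp
    have "ip S c (app S K' c) = ip S c (app S K c) - ip S c (app S (dyads [\<xi>]) c)"
      by (simp add: K'_def ip_def app_def algebra_simps sum_subtractf sum_distrib_left)
    then have q': "ip S c (app S K' c) = ip S c (app S K c) - \<alpha> * cnj \<alpha>"
      by (simp add: ip_app_dyads a1 a2 mult.commute del: dyads_simps)
    \<comment> \<open>As in the proof of the Cauchy-Schwarz inequality, the form is tested at a combination of \<open>c\<close> and \<open>z'\<close>.\<close>
    have "0 \<le> ip S (\<lambda>x. c x - \<alpha> * z' x) (app S K (\<lambda>x. c x - \<alpha> * z' x))"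
      using Cons.prems(1) by (simp add: psd_def)
    also have "\<dots> = ip S c (app S K c) - 2 * (\<alpha> * cnj \<alpha>) + \<alpha> * cnj \<alpha> * t"
      by (simp add: app_diff app_scale ip_diff_left ip_diff_right ip_scale_left ip_scale_right
          a1 \<xi>_def[symmetric] \<alpha>_def[symmetric] t_def[symmetric] algebra_simps)
    finally have "0 \<le> ip S c (app S K c) - 2 * (\<alpha> * cnj \<alpha>) + \<alpha> * cnj \<alpha> * t" .
    moreover have "\<alpha> * cnj \<alpha> * t \<le> \<alpha> * cnj \<alpha>"
    proof -
      have "(\<alpha> * cnj \<alpha>) * t \<le> (\<alpha> * cnj \<alpha>) * 1"
        by (rule mult_left_mono) (use t1 t2 in \<open>auto simp: less_eq_complex_def\<close>)
      then show ?thesis by simp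
    qed
    ultimately have "0 \<le> ip S c (app S K c) - 2 * (\<alpha> * cnj \<alpha>) + \<alpha> * cnj \<alpha>"
      by (meson add_left_mono order_trans)
    then show "0 \<le> ip S c (app S K' c)" by (simp add: q' algebra_simps)
  qed
  moreover have "K' x y = dyads W x y" if "x \<in> T" "y \<in> T" for x y
    using Cons.prems(2)[OF that] xi that by (simp add: K'_def)
  ultimately obtain F where F: "\<And>x y. x \<in> S \<Longrightarrow> y \<in> S \<Longrightarrow> K' x y = dyads F x y"
    and FW: "\<forall>f\<in>set F. (\<forall>x\<in>T. f x = 0) \<or> (\<exists>w\<in>set W. \<forall>x\<in>T. f x = w x)"
    using Cons.IH[of K'] by blast
  have "K x y = dyads (\<xi> # F) x y" if "x \<in> S" "y \<in> S" for x y
    using F[OF that] by (simp add: K'_def algebra_simps)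
  then show ?case
    using FW xi by (intro exI[of _ "\<xi> # F"]) auto
qed

section \<open>Tensor rank and the Schmidt decomposition\<close>

definition tensor_rank_le :: "'a set \<Rightarrow> 'b set \<Rightarrow> nat \<Rightarrow> ('a \<times> 'b \<Rightarrow> complex) \<Rightarrow> bool" where
  "tensor_rank_le I J k f \<longleftrightarrow> (\<exists>a b. \<forall>i\<in>I. \<forall>x\<in>J. f (i, x) = (\<Sum>j<k. a j i * b j x))"

lemma tensor_rank_leI:
  assumes "finite N" "card N \<le> k"
    and "\<And>i x. i \<in> I \<Longrightarrow> x \<in> J \<Longrightarrow> f (i, x) = (\<Sum>j\<in>N. a j i * b j x)"
  shows "tensor_rank_le I J k f"
proof -
  obtain h where h: "bij_betw h {..<card N} N"
    using ex_bij_betw_nat_finite[OF assms(1)] by (auto simp: atLeast0LessThan)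
  define a' where "a' j i = (if j < card N then a (h j) i else 0)" for j i
  have "f (i, x) = (\<Sum>j<k. a' j i * b (h j) x)" if "i \<in> I" "x \<in> J" for i x
  proof -
    have "f (i, x) = (\<Sum>j<card N. a (h j) i * b (h j) x)"
      unfolding assms(3)[OF that] by (rule sum.reindex_bij_betw[OF h, symmetric])
    also have "\<dots> = (\<Sum>j<k. a' j i * b (h j) x)"
      using assms(2) by (intro sum.mono_neutral_cong_left) (auto simp: a'_def)
    finally show ?thesis .
  qed
  then show ?thesis unfolding tensor_rank_le_def by (intro exI[of _ a'] exI[of _ "\<lambda>j. b (h j)"]) simp
qed

text \<open>
  Orthonormal families are linearly independent, so Steinitz applies. The functions are first replaced by the
  combinations of the \<open>b\<^sub>j\<close> that they agree with on \<open>J\<close>, since values outside \<open>J\<close> are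
  arbitrary.
\<close>

lemma orthonormal_in_span_card:
  fixes v :: "'i \<Rightarrow> 'b \<Rightarrow> complex"
  assumes N: "finite N" and on: "orthonormal J N v"
    and span: "\<And>i x. i \<in> N \<Longrightarrow> x \<in> J \<Longrightarrow> v i x = (\<Sum>j<k. c i j * b j x)"
  shows "card N \<le> k"
proof -
  interpret V: vector_space "\<lambda>(c::complex) (f :: 'b \<Rightarrow> complex) x. c * f x"
    by unfold_locales (auto simp: fun_eq_iff algebra_simps)
  define w where "w i x = (\<Sum>j<k. c i j * b j x)" for i x
  have sum_fun: "(\<Sum>a\<in>A. f a) x = (\<Sum>a\<in>A. f a x)" for A and f :: "'c \<Rightarrow> 'b \<Rightarrow> complex" and x
    by (induction A rule: infinite_finite_induct) auto
  have onw: "ip J (w i) (w j) = (if i = j then 1 else 0)" if "i \<in> N" "j \<in> N" for i j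
  proof -
    have "ip J (w i) (w j) = ip J (v i) (v j)"
      by (rule ip_cong) (simp_all add: w_def span that)
    then show ?thesis using on that by (simp add: orthonormal_def)
  qed
  have inj: "inj_on w N"
  proof (rule inj_onI)
    fix i j assume ij: "i \<in> N" "j \<in> N" "w i = w j"
    then have "ip J (w i) (w j) = 1" using onw[of j j] by simp
    then show "i = j" using onw[OF ij(1,2)] by (auto split: if_splits)
  qed
  have "V.independent (w ` N)"
    unfolding V.independent_explicit_finite_subsets
  proof (intro allI impI ballI)
    fix A u a
    assume A: "A \<subseteq> w ` N" "finite A" and z: "(\<Sum>v\<in>A. (\<lambda>x. u v * v x)) = 0" and a: "a \<in> A"
    have z': "(\<Sum>v\<in>A. u v * v x) = 0" for x
      using fun_cong[OF z, of x] by (simp add: sum_fun)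
    have "0 = ip J a (\<lambda>x. \<Sum>v\<in>A. u v * v x)"
      by (simp add: z' ip_def)
    also have "\<dots> = (\<Sum>v\<in>A. u v * ip J a v)"
      by (simp add: ip_sum_right ip_scale_right)
    also have "\<dots> = (\<Sum>v\<in>A. if v = a then u v else 0)"
    proof (rule sum.cong[OF refl])
      fix v assume "v \<in> A"
      then obtain i j where "a = w i" "v = w j" "i \<in> N" "j \<in> N"
        using A a by blast
      then show "u v * ip J a v = (if v = a then u v else 0)"
        using onw[of i j] inj by (auto dest: inj_onD)
    qed
    also have "\<dots> = u a" using A a by simp
    finally show "u a = 0" by simp
  qed
  moreover have "w ` N \<subseteq> V.span (b ` {..<k})"
  proof
    fix f assume "f \<in> w ` N"
    then obtain i where "f = w i" by blast
    then have "f = (\<Sum>j<k. (\<lambda>x. c i j * b j x))"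
      by (simp add: fun_eq_iff w_def sum_fun)
    also have "\<dots> \<in> V.span (b ` {..<k})"
      by (intro V.span_sum V.span_scale V.span_base) auto
    finally show "f \<in> V.span (b ` {..<k})" .
  qed
  ultimately have "card (w ` N) \<le> card (b ` {..<k})"
    using V.independent_span_bound[of "b ` {..<k}" "w ` N"] by simp
  also have "\<dots> \<le> k" using card_image_le[of "{..<k}" b] by simp
  finally show ?thesis by (simp add: card_image[OF inj])
qed

text \<open>
  Pairing a Schmidt decomposition with \<open>u\<^sub>n\<close> in the first factor isolates \<open>l\<^sub>n v\<^sub>n\<close>, and pairing
  any other decomposition into product vectors gives a combination of its second factors. So all
  \<open>v\<^sub>n\<close> lie in the span of \<open>k\<close> vectors.
\<close>

lemma schmidt_terms_le_tensor_rank: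
  fixes u :: "'i \<Rightarrow> 'a \<Rightarrow> complex" and v :: "'i \<Rightarrow> 'b \<Rightarrow> complex"
  assumes N: "finite N" and l: "\<And>i. i \<in> N \<Longrightarrow> l i \<noteq> 0"
    and onu: "orthonormal I N u" and onv: "orthonormal J N v"
    and f: "\<And>i x. i \<in> I \<Longrightarrow> x \<in> J \<Longrightarrow> f (i, x) = (\<Sum>j\<in>N. l j * (u j i * v j x))"
    and "tensor_rank_le I J k f"
  shows "card N \<le> k"
proof -
  obtain a b where ab: "\<And>i x. i \<in> I \<Longrightarrow> x \<in> J \<Longrightarrow> f (i, x) = (\<Sum>j<k. a j i * b j x)"
    using assms(6) unfolding tensor_rank_le_def by blast
  show ?thesis
  proof (rule orthonormal_in_span_card[OF N onv])
    fix n x assume n: "n \<in> N" and x: "x \<in> J"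
    have "l n * v n x = (\<Sum>j\<in>N. if j = n then l j * v j x else 0)"
      using N n by simp
    also have "\<dots> = (\<Sum>j\<in>N. (l j * v j x) * ip I (u n) (u j))"
      by (intro sum.cong refl) (use onu n in \<open>auto simp: orthonormal_def\<close>)
    also have "\<dots> = ip I (u n) (\<lambda>i. \<Sum>j\<in>N. (l j * v j x) * u j i)"
      by (simp add: ip_sum_right ip_scale_right)
    also have "\<dots> = ip I (u n) (\<lambda>i. \<Sum>j<k. b j x * a j i)"
      using f[OF _ x] ab[OF _ x] by (intro ip_cong) (simp_all add: algebra_simps)
    also have "\<dots> = (\<Sum>j<k. ip I (u n) (a j) * b j x)"
      by (simp only: ip_sum_right ip_scale_right) (simp add: mult.commute)
    finally show "v n x = (\<Sum>j<k. (ip I (u n) (a j) / l n) * b j x)"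
      using l[OF n] by (simp add: sum_divide_distrib[symmetric] field_simps)
  qed
qed

text \<open>
  The singular value decomposition of \<open>f\<close>, read as a matrix \<open>M\<close> with rows \<open>I\<close> and columns
  \<open>J\<close>. The spectral form of \<open>K = M M\<^sup>*\<close> provides the left vectors \<open>u\<^sub>j\<close>. The vectors
  \<open>h\<^sub>j = u\<^sub>j\<^sup>* M\<close> are orthogonal with squared norms the eigenvalues, and normalising them gives the right
  vectors. Nothing of \<open>M\<close> is lost by projecting on the \<open>u\<^sub>j\<close>, since they span its range.
\<close>

theorem schmidt_decomposition_exists:
  assumes I: "finite I" and J: "finite J"
  shows "\<exists>(r::nat) s u v. (\<forall>i<r. 0 < (s i :: real)) \<and> orthonormal I {..<r} u \<and> orthonormal J {..<r} v \<and>
    (\<forall>i\<in>I. \<forall>x\<in>J. f (i, x) = (\<Sum>j<r. complex_of_real (s j) * (u j i * v j x)))"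
proof -
  define K where "K = (\<lambda>i i'. \<Sum>x\<in>J. f (i, x) * cnj (f (i', x)))"
  have ipK: "ip I c (app I K d) = (\<Sum>x\<in>J. ip I c (\<lambda>i. f (i, x)) * ip I (\<lambda>i. f (i, x)) d)" for c d
    unfolding K_def by (rule ip_app_dyad[OF J])
  have "psd I K"
    unfolding psd_def ipK
    by (intro allI sum_nonneg ip_mult_ip_nonneg)
  then obtain r :: nat and l u where l: "\<And>i. i < r \<Longrightarrow> 0 < (l i :: real)" and onu: "orthonormal I {..<r} u"
    and K: "\<And>x y. x \<in> I \<Longrightarrow> y \<in> I \<Longrightarrow> K x y = (\<Sum>i<r. complex_of_real (l i) * (u i x * cnj (u i y)))"
    using psd_has_spectral_form[OF I] unfolding has_spectral_form_def by blast
  have Ku: "app I K (u j) i = complex_of_real (l j) * u j i" if "j < r" "i \<in> I" for i j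
  proof -
    have "app I K (u j) i = app I (\<lambda>x y. \<Sum>i<r. (complex_of_real (l i) * u i x) * cnj (u i y)) (u j) i"
      by (rule app_cong) (simp_all add: K that algebra_simps)
    also have "\<dots> = (\<Sum>m<r. if m = j then complex_of_real (l m) * u m i else 0)"
      unfolding app_dyad by (intro sum.cong refl) (use onu that in \<open>auto simp: orthonormal_def\<close>)
    finally show ?thesis using that by simp
  qed
  define h where "h = (\<lambda>j x. ip I (u j) (\<lambda>i. f (i, x)))"
  have hf: "ip J (h j) (\<lambda>x. f (i, x)) = complex_of_real (l j) * u j i" if "j < r" "i \<in> I" for i j
  proof -
    have "app I K (u j) i = (\<Sum>x\<in>J. f (i, x) * ip I (\<lambda>i. f (i, x)) (u j))"
      unfolding K_def by (rule app_dyad)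
    also have "\<dots> = ip J (h j) (\<lambda>x. f (i, x))"
      unfolding ip_def[of J] h_def by (subst (2) ip_commute) (simp add: mult.commute)
    finally show ?thesis using Ku[OF that] by simp
  qed
  have hh: "ip J (h j) (h j') = (if j = j' then complex_of_real (l j) else 0)" if "j < r" "j' < r" for j j'
  proof -
    have "ip J (h j) (h j') = ip I (u j') (app I K (u j))"
      unfolding ipK ip_def[of J] h_def by (subst (3) ip_commute) (simp add: mult.commute)
    also have "\<dots> = ip I (u j') (\<lambda>i. complex_of_real (l j) * u j i)"
      by (rule ip_cong) (simp_all add: Ku that)
    finally show ?thesis using onu that by (auto simp: ip_scale_right orthonormal_def)
  qed
  have f: "f (i, x) = (\<Sum>j<r. u j i * h j x)" if i: "i \<in> I" and x: "x \<in> J" for i x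
  proof -
    \<comment> \<open>The residual \<open>R\<close> of row \<open>i\<close> is orthogonal to the projection, and to the row itself since
      both inner products equal \<open>K i i\<close>.\<close>
    define p where "p = (\<lambda>x. \<Sum>j<r. u j i * h j x)"
    define R where "R = (\<lambda>x. f (i, x) - p x)"
    have hR: "ip J (h j) R = 0" if "j < r" for j
    proof -
      have "ip J (h j) p = (\<Sum>j'<r. if j' = j then u j' i * complex_of_real (l j') else 0)"
        unfolding p_def ip_sum_right ip_scale_right
        by (intro sum.cong refl) (use hh that in auto)
      then show ?thesis using that hf[OF that i] by (simp add: R_def ip_diff_right)
    qed
    have "ip J p R = 0"
      unfolding p_def ip_sum_left ip_scale_left by (simp add: hR)
    moreover have "ip J R (\<lambda>x. f (i, x)) = 0"
    proof -
      have "ip J p (\<lambda>x. f (i, x)) = (\<Sum>j<r. complex_of_real (l j) * (u j i * cnj (u j i)))"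
        unfolding p_def ip_sum_left ip_scale_left by (simp add: hf[OF _ i] algebra_simps)
      moreover have "ip J (\<lambda>x. f (i, x)) (\<lambda>x. f (i, x)) = K i i"
        by (simp add: ip_def K_def mult.commute)
      ultimately show ?thesis
        by (simp add: R_def ip_diff_left K[OF i i])
    qed
    moreover have "ip J R R = ip J R (\<lambda>x. f (i, x)) - ip J R p"
      by (subst (2) R_def) (rule ip_diff_right)
    moreover have "ip J R p = cnj (ip J p R)" by (rule ip_commute)
    ultimately have "ip J R R = 0" by simp
    then show ?thesis using ip_self_eq_0[OF J _ x, of R] by (simp add: R_def p_def)
  qed
  define s where "s j = sqrt (l j)" for j
  define v where "v = (\<lambda>j x. (1 / complex_of_real (s j)) * h j x)"
  have s: "0 < s j" "complex_of_real (s j) * complex_of_real (s j) = complex_of_real (l j)"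
    "complex_of_real (l j) \<noteq> 0" if "j < r" for j
    using l[OF that] by (simp_all add: s_def flip: of_real_mult)
  have "ip J (v j) (v j') = (if j = j' then 1 else 0)" if "j < r" "j' < r" for j j'
  proof -
    have "ip J (v j) (v j') = ip J (h j) (h j') / (complex_of_real (s j) * complex_of_real (s j'))"
      unfolding v_def ip_scale_left ip_scale_right by simp
    then show ?thesis using hh[OF that] s(2,3)[OF that(1)] by (cases "j = j'") auto
  qed
  then have "orthonormal J {..<r} v" by (simp add: orthonormal_def)
  moreover have "f (i, x) = (\<Sum>j<r. complex_of_real (s j) * (u j i * v j x))" if "i \<in> I" "x \<in> J" for i x
    unfolding f[OF that] by (intro sum.cong refl) (use s(1) in \<open>fastforce simp: v_def\<close>)
  ultimately show ?thesis using onu s(1) by blast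
qed

section \<open>Bipartite matrices as kernels on pairs of indices\<close>

abbreviation grid :: "nat \<Rightarrow> nat \<Rightarrow> (nat \<times> nat) set" where
  "grid m n \<equiv> {..<m} \<times> {..<n}"

text \<open>
  The position of \<open>e\<^sub>i \<otimes> e\<^sub>a\<close> in the basis of \<open>\<complex>\<^sup>m \<otimes> \<complex>\<^sup>n\<close>.
\<close>

definition pair_index :: "nat \<Rightarrow> nat \<times> nat \<Rightarrow> nat" where
  "pair_index n p = fst p * n + snd p"

lemma pair_index_less: "i < m \<Longrightarrow> a < n \<Longrightarrow> i * n + a < m * (n::nat)"
proof -
  assume "i < m" "a < n"
  then have "i * n + a < Suc i * n" by simp
  also have "\<dots> \<le> m * n" using \<open>i < m\<close> by (intro mult_right_mono) auto
  finally show ?thesis .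
qed

lemma pair_index_simps [simp]:
  "a < n \<Longrightarrow> (i * n + a) div n = i" "a < n \<Longrightarrow> (i * n + a) mod n = (a::nat)"
  by auto

lemma pair_index_bij: "bij_betw (pair_index n) (grid m n) {..<m * n}"
proof (rule bij_betw_byWitness[where f' = "\<lambda>x. (x div n, x mod n)"])
  show "\<forall>p\<in>grid m n. (pair_index n p div n, pair_index n p mod n) = p"
    by (auto simp: pair_index_def)
  show "\<forall>x\<in>{..<m * n}. pair_index n (x div n, x mod n) = x"
    by (simp add: pair_index_def)
  show "pair_index n ` grid m n \<subseteq> {..<m * n}"
    by (auto simp: pair_index_def pair_index_less)
  show "(\<lambda>x. (x div n, x mod n)) ` {..<m * n} \<subseteq> grid m n"
    by (auto simp: less_mult_imp_div_less) (metis mod_less_divisor gr0I less_nat_zero_code mult_0_right)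
qed

lemma pair_index_cases:
  assumes "y < m * n"
  obtains i x where "y = pair_index n (i, x)" "i < m" "x < n"
proof -
  have "y \<in> pair_index n ` grid m n"
    using assms pair_index_bij[of n m] by (simp add: bij_betw_def)
  then show thesis using that by auto
qed

lemma ip_pair_index: "ip {..<m * n} u v = ip (grid m n) (\<lambda>p. u (pair_index n p)) (\<lambda>p. v (pair_index n p))"
  unfolding ip_def by (rule sum.reindex_bij_betw[OF pair_index_bij, symmetric])

definition tensor_kernel :: "nat \<Rightarrow> complex mat \<Rightarrow> nat \<times> nat \<Rightarrow> nat \<times> nat \<Rightarrow> complex" where
  "tensor_kernel n X p q = X $$ (pair_index n p, pair_index n q)"

lemma mat_eq_iff_kernel:
  assumes "X \<in> carrier_mat (m * n) (m * n)" "Y \<in> carrier_mat (m * n) (m * n)"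
  shows "X = Y \<longleftrightarrow> (\<forall>p\<in>grid m n. \<forall>q\<in>grid m n. tensor_kernel n X p q = tensor_kernel n Y p q)"
proof
  assume *: "\<forall>p\<in>grid m n. \<forall>q\<in>grid m n. tensor_kernel n X p q = tensor_kernel n Y p q"
  show "X = Y"
  proof (rule eq_matI)
    fix s t assume "s < dim_row Y" "t < dim_col Y"
    then have "s \<in> pair_index n ` grid m n" "t \<in> pair_index n ` grid m n"
      using assms pair_index_bij[of n m] by (auto simp: bij_betw_def)
    then show "X $$ (s, t) = Y $$ (s, t)"
      using * unfolding tensor_kernel_def by blast
  qed (use assms in auto)
qed simp

lemma pos_semidef_iff_psd:
  "pos_semidef d X \<longleftrightarrow> X \<in> carrier_mat d d \<and> psd {..<d} (\<lambda>a b. X $$ (a, b))"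
proof (cases "X \<in> carrier_mat d d")
  case True
  have q: "(X *\<^sub>v v) \<bullet>c v = ip {..<d} (\<lambda>a. v $ a) (app {..<d} (\<lambda>a b. X $$ (a, b)) (\<lambda>a. v $ a))"
    if "v \<in> carrier_vec d" for v
    using True that by (simp add: scalar_prod_def ip_def app_def atLeast0LessThan mult.commute)
  have "(\<forall>v\<in>carrier_vec d. 0 \<le> (X *\<^sub>v v) \<bullet>c v) \<longleftrightarrow> psd {..<d} (\<lambda>a b. X $$ (a, b))"
  proof
    assume L: "\<forall>v\<in>carrier_vec d. 0 \<le> (X *\<^sub>v v) \<bullet>c v"
    show "psd {..<d} (\<lambda>a b. X $$ (a, b))"
      unfolding psd_def
    proof
      fix c
      have "ip {..<d} c (app {..<d} (\<lambda>a b. X $$ (a, b)) c) = (X *\<^sub>v vec d c) \<bullet>c vec d c"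
        unfolding q[OF vec_carrier] by (intro ip_cong app_cong) auto
      then show "0 \<le> ip {..<d} c (app {..<d} (\<lambda>a b. X $$ (a, b)) c)"
        using L by simp
    qed
  qed (simp add: q psd_def)
  then show ?thesis using True by (simp add: pos_semidef_def)
qed (simp add: pos_semidef_def)

lemma pos_semidef_iff_kernel:
  "pos_semidef (m * n) X \<longleftrightarrow> X \<in> carrier_mat (m * n) (m * n) \<and> psd (grid m n) (tensor_kernel n X)"
proof -
  let ?K = "\<lambda>a b. X $$ (a, b)"
  have q: "ip {..<m * n} c (app {..<m * n} ?K c)
    = ip (grid m n) (\<lambda>p. c (pair_index n p)) (app (grid m n) (tensor_kernel n X) (\<lambda>p. c (pair_index n p)))" for c
    unfolding ip_pair_index by (rule ip_cong) (auto simp: tensor_kernel_def[abs_def] app_def sum.reindex_bij_betw[OF pair_index_bij, symmetric])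
  have "psd {..<m * n} ?K \<longleftrightarrow> psd (grid m n) (tensor_kernel n X)"
  proof
    assume L: "psd {..<m * n} ?K"
    show "psd (grid m n) (tensor_kernel n X)"
      unfolding psd_def
    proof
      fix c :: "nat \<times> nat \<Rightarrow> complex"
      let ?c = "\<lambda>x. c (x div n, x mod n)"
      have "ip (grid m n) c (app (grid m n) (tensor_kernel n X) c) = ip {..<m * n} ?c (app {..<m * n} ?K ?c)"
        unfolding q by (intro ip_cong app_cong) (auto simp: pair_index_def)
      then show "0 \<le> ip (grid m n) c (app (grid m n) (tensor_kernel n X) c)"
        using L by (simp add: psd_def)
    qed
  qed (simp add: psd_def q)
  then show ?thesis by (simp add: pos_semidef_iff_psd)
qed

lemma pos_semidef_dyads:
  assumes "pos_semidef (m * n) X"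
  obtains F where "\<And>p q. p \<in> grid m n \<Longrightarrow> q \<in> grid m n \<Longrightarrow> tensor_kernel n X p q = dyads F p q"
  using psd_imp_dyads[of "grid m n" "tensor_kernel n X"] assms by (auto simp: pos_semidef_iff_kernel)

lemma pos_semidefI_dyads:
  assumes "X \<in> carrier_mat (m * n) (m * n)"
    and "\<And>p q. p \<in> grid m n \<Longrightarrow> q \<in> grid m n \<Longrightarrow> tensor_kernel n X p q = dyads F p q"
  shows "pos_semidef (m * n) X"
  using assms psd_dyads[of "grid m n" F] psd_cong[of "grid m n" "tensor_kernel n X" "dyads F"]
  by (simp add: pos_semidef_iff_kernel)

lemma mat_sum_carrier [simp]: "mat_sum d I F \<in> carrier_mat d d"
  by (simp add: mat_sum_def)

lemma mat_sum_index [simp]: "a < d \<Longrightarrow> b < d \<Longrightarrow> mat_sum d I F $$ (a, b) = (\<Sum>i\<in>I. F i $$ (a, b))"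
  by (simp add: mat_sum_def)

lemma mat_unit_carrier [simp]: "mat_unit d i j \<in> carrier_mat d d"
  by (simp add: mat_unit_def)

lemma block_carrier [simp]: "block d X i j \<in> carrier_mat d d"
  by (simp add: block_def)

lemma kernel_mat_sum:
  "p \<in> grid m n \<Longrightarrow> q \<in> grid m n \<Longrightarrow> tensor_kernel n (mat_sum (m * n) I F) p q = (\<Sum>i\<in>I. tensor_kernel n (F i) p q)"
  by (auto simp: tensor_kernel_def pair_index_def pair_index_less)

lemma kernel_tensor_mat:
  assumes "A \<in> carrier_mat m m" "B \<in> carrier_mat n n" "i < m" "j < m" "a < n" "b < n"
  shows "tensor_kernel n (tensor_mat A B) (i, a) (j, b) = A $$ (i, j) * B $$ (a, b)"
  using assms pair_index_less[of i m a n] pair_index_less[of j m b n] by (auto simp: tensor_kernel_def pair_index_def tensor_mat_def)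

lemma kernel_sum_tensor_units:
  assumes "\<And>i j. i < k \<Longrightarrow> j < k \<Longrightarrow> G i j \<in> carrier_mat d d" "i < k" "j < k" "a < d" "b < d"
  shows "tensor_kernel d (mat_sum (k * d) (grid k k) (\<lambda>(i, j). tensor_mat (mat_unit k i j) (G i j))) (i, a) (j, b)
    = G i j $$ (a, b)"
proof -
  have "tensor_kernel d (mat_sum (k * d) (grid k k) (\<lambda>(i, j). tensor_mat (mat_unit k i j) (G i j))) (i, a) (j, b)
    = (\<Sum>p\<in>grid k k. tensor_kernel d (tensor_mat (mat_unit k (fst p) (snd p)) (G (fst p) (snd p))) (i, a) (j, b))"
    using assms by (subst kernel_mat_sum) (auto simp: case_prod_unfold)
  also have "\<dots> = (\<Sum>p\<in>grid k k. if p = (i, j) then G i j $$ (a, b) else 0)"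
  proof (intro sum.cong refl)
    fix p assume "p \<in> grid k k"
    then have "tensor_kernel d (tensor_mat (mat_unit k (fst p) (snd p)) (G (fst p) (snd p))) (i, a) (j, b)
      = mat_unit k (fst p) (snd p) $$ (i, j) * G (fst p) (snd p) $$ (a, b)"
      using assms by (intro kernel_tensor_mat) auto
    then show "tensor_kernel d (tensor_mat (mat_unit k (fst p) (snd p)) (G (fst p) (snd p))) (i, a) (j, b)
      = (if p = (i, j) then G i j $$ (a, b) else 0)"
      using assms by (auto simp: mat_unit_def)
  qed
  also have "\<dots> = G i j $$ (a, b)" using assms by simp
  finally show ?thesis .
qed

lemma linear_map_carrier: "linear_map d1 d2 \<Phi> \<Longrightarrow> X \<in> carrier_mat d1 d1 \<Longrightarrow> \<Phi> X \<in> carrier_mat d2 d2"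
  by (simp add: linear_map_def)

lemma kernel_id_tensor:
  assumes "linear_map d1 d2 \<Phi>" "i < k" "j < k" "a < d2" "b < d2"
  shows "tensor_kernel d2 (id_tensor k d1 d2 \<Phi> X) (i, a) (j, b) = \<Phi> (block d1 X i j) $$ (a, b)"
  unfolding id_tensor_def
  by (rule kernel_sum_tensor_units) (use assms linear_map_carrier[OF assms(1)] in auto)

lemma kernel_choi_matrix:
  assumes "linear_map d1 d2 \<Phi>" "i < d1" "j < d1" "a < d2" "b < d2"
  shows "tensor_kernel d2 (choi_matrix d1 d2 \<Phi>) (i, a) (j, b) = \<Phi> (mat_unit d1 i j) $$ (a, b)"
  unfolding choi_matrix_def
  by (rule kernel_sum_tensor_units) (use assms linear_map_carrier[OF assms(1)] in auto)

lemma id_tensor_carrier [simp]: "id_tensor k d1 d2 \<Phi> X \<in> carrier_mat (k * d2) (k * d2)"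
  by (simp add: id_tensor_def)

lemma choi_matrix_carrier [simp]: "choi_matrix d1 d2 \<Phi> \<in> carrier_mat (d1 * d2) (d1 * d2)"
  by (simp add: choi_matrix_def)

lemma linear_map_mat_sum:
  assumes lin: "linear_map d1 d2 \<Phi>" and "finite I" and F: "\<And>i. i \<in> I \<Longrightarrow> F i \<in> carrier_mat d1 d1"
  shows "\<Phi> (mat_sum d1 I F) = mat_sum d2 I (\<lambda>i. \<Phi> (F i))"
  using assms(2,3)
proof (induction I rule: finite_induct)
  case empty
  define Z where "Z = mat_sum d1 {} F"
  have Z: "Z \<in> carrier_mat d1 d1" "Z = 0 \<cdot>\<^sub>m Z"
    by (auto simp: Z_def mat_sum_def)
  then have "\<Phi> Z = 0 \<cdot>\<^sub>m \<Phi> Z"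
    using lin by (metis linear_map_def)
  also have "\<dots> = mat_sum d2 {} (\<lambda>i. \<Phi> (F i))"
    using linear_map_carrier[OF lin Z(1)] by (intro eq_matI) (auto simp: mat_sum_def)
  finally show ?case by (simp add: Z_def)
next
  case (insert i I)
  have ins: "mat_sum d (insert i I) G = G i + mat_sum d I G" if "G i \<in> carrier_mat d d" for d and G :: "'a \<Rightarrow> complex mat"
    using that insert.hyps by (intro eq_matI) (auto simp: mat_sum_def)
  have "\<Phi> (mat_sum d1 (insert i I) F) = \<Phi> (F i) + \<Phi> (mat_sum d1 I F)"
    using lin insert.prems by (subst ins) (auto simp: linear_map_def)
  then show ?case
    using insert linear_map_carrier[OF lin] by (subst ins) auto
qed

lemma linear_map_index:
  assumes lin: "linear_map d1 d2 \<Phi>" and X: "X \<in> carrier_mat d1 d1" and ab: "a < d2" "b < d2"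
  shows "\<Phi> X $$ (a, b) = (\<Sum>i<d1. \<Sum>j<d1. X $$ (i, j) * tensor_kernel d2 (choi_matrix d1 d2 \<Phi>) (i, a) (j, b))"
proof -
  let ?F = "\<lambda>p. X $$ p \<cdot>\<^sub>m mat_unit d1 (fst p) (snd p)"
  have "X = mat_sum d1 (grid d1 d1) ?F"
  proof (rule eq_matI)
    fix s t assume st: "s < dim_row (mat_sum d1 (grid d1 d1) ?F)" "t < dim_col (mat_sum d1 (grid d1 d1) ?F)"
    then have "s < d1" "t < d1" by (simp_all add: mat_sum_def)
    have "mat_sum d1 (grid d1 d1) ?F $$ (s, t) = (\<Sum>p\<in>grid d1 d1. if p = (s, t) then X $$ p else 0)"
      unfolding mat_sum_index[OF \<open>s < d1\<close> \<open>t < d1\<close>] using \<open>s < d1\<close> \<open>t < d1\<close>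
      by (intro sum.cong refl) (auto simp: mat_unit_def)
    then show "X $$ (s, t) = mat_sum d1 (grid d1 d1) ?F $$ (s, t)"
      using \<open>s < d1\<close> \<open>t < d1\<close> by simp
  qed (use X in \<open>auto simp: mat_sum_def\<close>)
  then have "\<Phi> X = mat_sum d2 (grid d1 d1) (\<lambda>p. \<Phi> (?F p))"
    using linear_map_mat_sum[OF lin, of "grid d1 d1" ?F] by simp
  then have "\<Phi> X $$ (a, b) = (\<Sum>p\<in>grid d1 d1. \<Phi> (?F p) $$ (a, b))"
    using ab by simp
  also have "\<dots> = (\<Sum>p\<in>grid d1 d1. X $$ p * tensor_kernel d2 (choi_matrix d1 d2 \<Phi>) (fst p, a) (snd p, b))"
  proof (rule sum.cong[OF refl])
    fix p assume p: "p \<in> grid d1 d1"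
    have "\<Phi> (?F p) = X $$ p \<cdot>\<^sub>m \<Phi> (mat_unit d1 (fst p) (snd p))"
      using lin by (simp add: linear_map_def)
    then show "\<Phi> (?F p) $$ (a, b) = X $$ p * tensor_kernel d2 (choi_matrix d1 d2 \<Phi>) (fst p, a) (snd p, b)"
      using p ab linear_map_carrier[OF lin mat_unit_carrier, of "fst p" "snd p"]
      by (auto simp: kernel_choi_matrix[OF lin])
  qed
  finally show ?thesis by (simp add: sum.cartesian_product case_prod_unfold)
qed

lemma kernel_id_tensor_choi:
  assumes lin: "linear_map d1 d2 \<Phi>" and "i < k" "j < k" "a < d2" "b < d2"
  shows "tensor_kernel d2 (id_tensor k d1 d2 \<Phi> X) (i, a) (j, b) =
    (\<Sum>x<d1. \<Sum>y<d1. tensor_kernel d1 X (i, x) (j, y) * tensor_kernel d2 (choi_matrix d1 d2 \<Phi>) (x, a) (y, b))"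
  using assms by (simp add: kernel_id_tensor linear_map_index[OF lin])
    (simp add: block_def tensor_kernel_def[of d1] pair_index_def)

lemma dyads_concat: "dyads (concat Fs) x y = (\<Sum>F\<leftarrow>Fs. dyads F x y)"
  by (induction Fs) simp_all

text \<open>
  The matrix product of \<open>h\<close> and \<open>f\<close>. It arises because applying a map whose Choi matrix contains
  \<open>|f\<rangle>\<langle>f|\<close> to one factor of \<open>|h\<rangle>\<langle>h|\<close> contracts the common index.
\<close>

definition contract :: "nat \<Rightarrow> (nat \<times> nat \<Rightarrow> complex) \<Rightarrow> (nat \<times> nat \<Rightarrow> complex) \<Rightarrow> nat \<times> nat \<Rightarrow> complex" where
  "contract d h f = (\<lambda>(i, a). \<Sum>x<d. h (i, x) * f (x, a))"

lemma contract_dyads: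
  "(\<Sum>x<d. \<Sum>y<d. dyads H (i, x) (j, y) * dyads F (x, a) (y, b))
    = dyads (concat (map (\<lambda>h. map (contract d h) F) H)) (i, a) (j, b)"
proof (induction H)
  case (Cons h H)
  have one: "(\<Sum>x<d. \<Sum>y<d. h (i, x) * cnj (h (j, y)) * dyads F (x, a) (y, b)) = dyads (map (contract d h) F) (i, a) (j, b)"
  proof (induction F)
    case (Cons f F)
    have "(\<Sum>x<d. \<Sum>y<d. h (i, x) * cnj (h (j, y)) * (f (x, a) * cnj (f (y, b))))
      = contract d h f (i, a) * cnj (contract d h f (j, b))"
      by (simp add: contract_def sum_product algebra_simps)
    then show ?case
      using Cons by (simp add: distrib_left sum.distrib)
  qed simp
  then show ?case
    using Cons by (simp add: distrib_right sum.distrib)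
qed simp

lemma tensor_rank_contract_left:
  assumes "tensor_rank_le {..<m} {..<d} k h"
  shows "tensor_rank_le {..<m} J k (contract d h f)"
proof -
  obtain a b where "\<And>i x. i < m \<Longrightarrow> x < d \<Longrightarrow> h (i, x) = (\<Sum>j<k. a j i * b j x)"
    using assms unfolding tensor_rank_le_def by auto
  then have "contract d h f (i, y) = (\<Sum>j<k. a j i * (\<Sum>x<d. b j x * f (x, y)))" if "i < m" for i y
    using that by (simp add: contract_def sum_distrib_left sum_distrib_right mult.assoc sum.swap[of _ _ "{..<d}"])
  then show ?thesis
    unfolding tensor_rank_le_def by (intro exI[of _ a] exI[of _ "\<lambda>j y. \<Sum>x<d. b j x * f (x, y)"]) simp
qed

lemma tensor_rank_contract_right:
  assumes "tensor_rank_le {..<d} J k f"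
  shows "tensor_rank_le I J k (contract d h f)"
proof -
  obtain a b where "\<And>i x. i < d \<Longrightarrow> x \<in> J \<Longrightarrow> f (i, x) = (\<Sum>j<k. a j i * b j x)"
    using assms unfolding tensor_rank_le_def by auto
  then have "contract d h f (i, y) = (\<Sum>j<k. (\<Sum>x<d. h (i, x) * a j x) * b j y)" if "y \<in> J" for i y
    using that by (simp add: contract_def sum_distrib_left sum_distrib_right mult.assoc sum.swap[of _ _ "{..<d}"])
  then show ?thesis
    unfolding tensor_rank_le_def by (intro exI[of _ "\<lambda>j i. \<Sum>x<d. h (i, x) * a j x"] exI[of _ b]) simp
qed

section \<open>Schmidt numbers and separability\<close>

text \<open>
  Schmidt number at most \<open>k\<close>, in a form closed under the operations below. Tensor rank replaces Schmidt rank, and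
  no minimum is taken. The agreement with \<open>schmidt_number\<close> for \<open>k \<ge> 1\<close> is
  \<open>schmidt_number_le_iff\<close>.
\<close>

definition schmidt_number_le :: "nat \<Rightarrow> nat \<Rightarrow> nat \<Rightarrow> complex mat \<Rightarrow> bool" where
  "schmidt_number_le k m n X \<longleftrightarrow> X \<in> carrier_mat (m * n) (m * n) \<and>
     (\<exists>F. (\<forall>f\<in>set F. tensor_rank_le {..<m} {..<n} k f) \<and>
          (\<forall>p\<in>grid m n. \<forall>q\<in>grid m n. tensor_kernel n X p q = dyads F p q))"

lemma tensor_rank_le_mono:
  assumes "tensor_rank_le I J k f" "k \<le> k'"
  shows "tensor_rank_le I J k' f"
proof -
  obtain a b where "\<And>i x. i \<in> I \<Longrightarrow> x \<in> J \<Longrightarrow> f (i, x) = (\<Sum>j<k. a j i * b j x)"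
    using assms(1) unfolding tensor_rank_le_def by blast
  then show ?thesis using assms(2) by (intro tensor_rank_leI[of "{..<k}"]) auto
qed

lemma tensor_rank_le_dim: "tensor_rank_le {..<m} J m f"
proof (rule tensor_rank_leI[of "{..<m}"])
  fix i x assume "i \<in> {..<m}"
  then show "f (i, x) = (\<Sum>j<m. (if i = j then 1 else 0) * f (j, x))"
    by (simp add: if_distrib[of "\<lambda>c. c * _"] cong: if_cong)
qed auto

lemma schmidt_number_le_mono: "schmidt_number_le k m n X \<Longrightarrow> k \<le> k' \<Longrightarrow> schmidt_number_le k' m n X"
  unfolding schmidt_number_le_def using tensor_rank_le_mono by blast

lemma schmidt_number_le_psd: "schmidt_number_le k m n X \<Longrightarrow> pos_semidef (m * n) X"
  unfolding schmidt_number_le_def by (blast intro: pos_semidefI_dyads)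

lemma schmidt_number_le_dim: "pos_semidef (m * n) X \<Longrightarrow> schmidt_number_le m m n X"
  unfolding schmidt_number_le_def
  by (metis pos_semidef_dyads pos_semidef_iff_kernel tensor_rank_le_dim)

lemma orthonormal_family_iff:
  "orthonormal_family d r u \<longleftrightarrow> (\<forall>i<r. u i \<in> carrier_vec d) \<and> orthonormal {..<d} {..<r} (\<lambda>i x. u i $ x)"
proof -
  have "u i \<bullet>c u j = ip {..<d} (\<lambda>x. u j $ x) (\<lambda>x. u i $ x)" if "u i \<in> carrier_vec d" "u j \<in> carrier_vec d" for i j
    using that by (simp add: scalar_prod_def ip_def atLeast0LessThan mult.commute)
  then show ?thesis
    unfolding orthonormal_family_def orthonormal_def by (auto split: if_splits)
qed

lemma schmidt_sum_index:
  fixes r :: nat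
  assumes "\<And>j. j < r \<Longrightarrow> u j \<in> carrier_vec m" "\<And>j. j < r \<Longrightarrow> v j \<in> carrier_vec n" "i < m" "x < n"
  shows "finsum_vec TYPE(complex) (m * n) (\<lambda>j. complex_of_real (l j) \<cdot>\<^sub>v tensor_vec (u j) (v j)) {..<r} $ pair_index n (i, x)
     = (\<Sum>j<r. complex_of_real (l j) * (u j $ i * v j $ x))"
proof -
  have t: "tensor_vec (u j) (v j) \<in> carrier_vec (m * n)" "tensor_vec (u j) (v j) $ pair_index n (i, x) = u j $ i * v j $ x"
    if "j < r" for j
    using assms(1,2)[OF that] assms(3,4) pair_index_less[OF assms(3,4)] by (auto simp: tensor_vec_def pair_index_def)
  have "finsum_vec TYPE(complex) (m * n) (\<lambda>j. complex_of_real (l j) \<cdot>\<^sub>v tensor_vec (u j) (v j)) {..<r} $ pair_index n (i, x)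
    = (\<Sum>j<r. (complex_of_real (l j) \<cdot>\<^sub>v tensor_vec (u j) (v j)) $ pair_index n (i, x))"
    using pair_index_less[OF assms(3,4)] t(1) by (intro index_finsum_vec) (auto simp: pair_index_def)
  also have "\<dots> = (\<Sum>j<r. complex_of_real (l j) * (u j $ i * v j $ x))"
  proof (intro sum.cong refl)
    fix j assume "j \<in> {..<r}"
    then show "(complex_of_real (l j) \<cdot>\<^sub>v tensor_vec (u j) (v j)) $ pair_index n (i, x)
        = complex_of_real (l j) * (u j $ i * v j $ x)"
      using t[of j] pair_index_less[OF assms(3,4)] by (subst index_smult_vec) (auto simp: pair_index_def)
  qed
  finally show ?thesis .
qed

text \<open>
  By the comparison with tensor rank, the number of nonzero Schmidt coefficients is the same for all Schmidt decompositions. So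
  the definite description in the definition of \<open>schmidt_rank\<close> denotes, and its value is the
  tensor rank.
\<close>

lemma schmidt_rank_le_iff:
  assumes \<xi>: "\<xi> \<in> carrier_vec (m * n)"
  shows "schmidt_rank m n \<xi> \<le> k \<longleftrightarrow> tensor_rank_le {..<m} {..<n} k (\<lambda>p. \<xi> $ pair_index n p)"
proof -
  define f where "f = (\<lambda>p. \<xi> $ pair_index n p)"
  define P where "P s \<longleftrightarrow> (\<exists>r l u v. schmidt_decomposition m n \<xi> r l u v \<and> s = card {i. i < r \<and> l i \<noteq> 0})" for s
  have P: "s \<le> k \<longleftrightarrow> tensor_rank_le {..<m} {..<n} k f" if Ps: "P s" for s k
  proof -
    obtain r l u v where sd: "schmidt_decomposition m n \<xi> r l u v" and s: "s = card {i. i < r \<and> l i \<noteq> 0}"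
      using Ps unfolding P_def by blast
    define N where "N = {i. i < r \<and> l i \<noteq> 0}"
    have fin: "finite N" by (simp add: N_def)
    have on: "orthonormal {..<m} {..<r} (\<lambda>i x. u i $ x)" "orthonormal {..<n} {..<r} (\<lambda>i x. v i $ x)"
      and car: "\<And>i. i < r \<Longrightarrow> u i \<in> carrier_vec m" "\<And>i. i < r \<Longrightarrow> v i \<in> carrier_vec n"
      using sd by (auto simp: schmidt_decomposition_def orthonormal_family_iff)
    have f: "f (i, x) = (\<Sum>j\<in>N. complex_of_real (l j) * (u j $ i * v j $ x))" if "i < m" "x < n" for i x
    proof -
      have "f (i, x) = (\<Sum>j<r. complex_of_real (l j) * (u j $ i * v j $ x))"
        using sd schmidt_sum_index[OF car that] by (simp add: schmidt_decomposition_def f_def)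
      also have "\<dots> = (\<Sum>j\<in>N. complex_of_real (l j) * (u j $ i * v j $ x))"
        by (intro sum.mono_neutral_right) (auto simp: N_def)
      finally show ?thesis .
    qed
    show ?thesis
    proof
      assume "s \<le> k"
      then show "tensor_rank_le {..<m} {..<n} k f"
        using fin f by (intro tensor_rank_leI[of N k _ _ f "\<lambda>j i. complex_of_real (l j) * u j $ i" "\<lambda>j x. v j $ x"])
          (auto simp: s N_def[symmetric] mult.assoc)
    next
      assume "tensor_rank_le {..<m} {..<n} k f"
      moreover have "orthonormal {..<m} N (\<lambda>i x. u i $ x)" "orthonormal {..<n} N (\<lambda>i x. v i $ x)"
        using on by (auto simp: orthonormal_def N_def)
      ultimately show "s \<le> k"
        using schmidt_terms_le_tensor_rank[OF fin, of "\<lambda>j. complex_of_real (l j)" "{..<m}" _ "{..<n}" _ f k] f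
        by (auto simp: s N_def[symmetric]) (simp add: N_def)
    qed
  qed
  have "\<exists>s. P s"
  proof -
    obtain r :: nat and s u v where s: "\<forall>i<r. 0 < (s i :: real)"
      and on: "orthonormal {..<m} {..<r} u" "orthonormal {..<n} {..<r} v"
      and f': "\<forall>i\<in>{..<m}. \<forall>x\<in>{..<n}. f (i, x) = (\<Sum>j<r. complex_of_real (s j) * (u j i * v j x))"
      using schmidt_decomposition_exists[OF finite_lessThan[of m] finite_lessThan[of n], of f] by blast
    have f: "f (i, x) = (\<Sum>j<r. complex_of_real (s j) * (u j i * v j x))" if "i < m" "x < n" for i x
      using f' that by blast
    define U where "U j = vec m (u j)" for j
    define V where "V j = vec n (v j)" for j
    have on': "orthonormal_family m r U" "orthonormal_family n r V"
      using on unfolding orthonormal_family_iff orthonormal_def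
      by (auto simp: U_def V_def ip_def)
    have "\<xi> = finsum_vec TYPE(complex) (m * n) (\<lambda>j. complex_of_real (s j) \<cdot>\<^sub>v tensor_vec (U j) (V j)) {..<r}"
    proof (rule eq_vecI)
      have car: "(\<lambda>j. complex_of_real (s j) \<cdot>\<^sub>v tensor_vec (U j) (V j)) \<in> {..<r} \<rightarrow> carrier_vec (m * n)"
        by (auto simp: tensor_vec_def U_def V_def)
      show dim: "dim_vec \<xi> = dim_vec (finsum_vec TYPE(complex) (m * n) (\<lambda>j. complex_of_real (s j) \<cdot>\<^sub>v tensor_vec (U j) (V j)) {..<r})"
        using \<xi> finsum_vec_closed[OF car] by auto
      fix y assume "y < dim_vec (finsum_vec TYPE(complex) (m * n) (\<lambda>j. complex_of_real (s j) \<cdot>\<^sub>v tensor_vec (U j) (V j)) {..<r})"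
      then have "y < m * n" using dim \<xi> by auto
      then obtain i x where y: "y = pair_index n (i, x)" "i < m" "x < n"
        by (rule pair_index_cases)
      show "\<xi> $ y = finsum_vec TYPE(complex) (m * n) (\<lambda>j. complex_of_real (s j) \<cdot>\<^sub>v tensor_vec (U j) (V j)) {..<r} $ y"
        using f[OF y(2,3)] y unfolding y(1)
        by (subst schmidt_sum_index) (auto simp: U_def V_def f_def)
    qed
    then have "schmidt_decomposition m n \<xi> r s U V"
      using on' s by (auto simp: schmidt_decomposition_def less_imp_le)
    then show ?thesis unfolding P_def by blast
  qed
  moreover have "s = s'" if "P s" "P s'" for s s'
    using P[OF that(1), of s] P[OF that(2), of s] P[OF that(1), of s'] P[OF that(2), of s'] by auto
  ultimately have "P (THE s. P s)" by (metis theI)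
  then have "P (schmidt_rank m n \<xi>)"
    by (simp add: schmidt_rank_def P_def)
  then show ?thesis using P by (simp add: f_def)
qed

lemma kernel_rank_one:
  assumes "\<xi> \<in> carrier_vec (m * n)" "p \<in> grid m n" "q \<in> grid m n"
  shows "tensor_kernel n (rank_one \<xi>) p q = \<xi> $ pair_index n p * cnj (\<xi> $ pair_index n q)"
  using assms pair_index_less[of "fst p" m "snd p" n] pair_index_less[of "fst q" m "snd q" n]
  by (auto simp: tensor_kernel_def rank_one_def pair_index_def)

text \<open>
  Decompositions of kernels and decompositions into vectors correspond to each other. The spectral theorem makes sure
  that a positive semidefinite matrix has one, so that the least element in the definition of
  \<open>schmidt_number\<close> is attained. The bound \<open>1 \<le> k\<close> reflects the convention for the zero matrix.
\<close>

theorem schmidt_number_le_iff: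
  assumes "1 \<le> k"
  shows "schmidt_number_le k m n X \<longleftrightarrow> pos_semidef (m * n) X \<and> schmidt_number m n X \<le> k"
proof -
  define P where "P s \<longleftrightarrow> (\<exists>(r::nat) \<xi>. (\<forall>i<r. \<xi> i \<in> carrier_vec (m * n)) \<and>
        X = mat_sum (m * n) {..<r} (\<lambda>i. rank_one (\<xi> i)) \<and>
        s = Max (insert 1 ((\<lambda>i. schmidt_rank m n (\<xi> i)) ` {..<r})))" for s
  have P: "\<exists>s\<le>max 1 k. P s" if X: "schmidt_number_le k m n X" for k
  proof -
    obtain F where F: "\<And>f. f \<in> set F \<Longrightarrow> tensor_rank_le {..<m} {..<n} k f"
      and K: "\<And>p q. p \<in> grid m n \<Longrightarrow> q \<in> grid m n \<Longrightarrow> tensor_kernel n X p q = dyads F p q"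
      using X unfolding schmidt_number_le_def by blast
    define \<xi> where "\<xi> i = vec (m * n) (\<lambda>x. (F ! i) (x div n, x mod n))" for i
    have car: "\<xi> i \<in> carrier_vec (m * n)" for i by (simp add: \<xi>_def)
    have xi: "\<xi> i $ pair_index n p = (F ! i) p" if "p \<in> grid m n" for i p
      using that by (auto simp: \<xi>_def pair_index_def pair_index_less)
    have "X = mat_sum (m * n) {..<length F} (\<lambda>i. rank_one (\<xi> i))"
    proof (subst mat_eq_iff_kernel[of _ m n])
      show "X \<in> carrier_mat (m * n) (m * n)" using X by (simp add: schmidt_number_le_def)
      show "\<forall>p\<in>grid m n. \<forall>q\<in>grid m n. tensor_kernel n X p q = tensor_kernel n (mat_sum (m * n) {..<length F} (\<lambda>i. rank_one (\<xi> i))) p q"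
      proof (intro ballI)
        fix p q assume pq: "p \<in> grid m n" "q \<in> grid m n"
        show "tensor_kernel n X p q = tensor_kernel n (mat_sum (m * n) {..<length F} (\<lambda>i. rank_one (\<xi> i))) p q"
          unfolding K[OF pq] kernel_mat_sum[OF pq] kernel_rank_one[OF car pq]
          by (simp add: xi pq dyads_def sum_list_sum_nth atLeast0LessThan)
      qed
    qed simp
    moreover have "schmidt_rank m n (\<xi> i) \<le> k" if "i < length F" for i
    proof -
      have "tensor_rank_le {..<m} {..<n} k (\<lambda>p. \<xi> i $ pair_index n p)"
        using F[OF nth_mem[OF that]] xi unfolding tensor_rank_le_def by auto
      then show ?thesis by (simp add: schmidt_rank_le_iff[OF car])
    qed
    then have "Max (insert 1 ((\<lambda>i. schmidt_rank m n (\<xi> i)) ` {..<length F})) \<le> max 1 k"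
      by (subst Max_le_iff) (auto simp: le_max_iff_disj)
    ultimately show ?thesis unfolding P_def using car by blast
  qed
  have L: "schmidt_number m n X = (LEAST s. P s)"
    by (simp add: schmidt_number_def P_def)
  show ?thesis
  proof
    assume X: "schmidt_number_le k m n X"
    then obtain s where "s \<le> max 1 k" "P s" using P by blast
    then have "schmidt_number m n X \<le> k"
      unfolding L using Least_le[of P s] assms by auto
    then show "pos_semidef (m * n) X \<and> schmidt_number m n X \<le> k"
      using schmidt_number_le_psd[OF X] by blast
  next
    assume X: "pos_semidef (m * n) X \<and> schmidt_number m n X \<le> k"
    then obtain s where "P s" using P[OF schmidt_number_le_dim] by blast
    then have "P (schmidt_number m n X)" unfolding L by (rule LeastI)
    then obtain r :: nat and \<xi> where car: "\<And>i. i < r \<Longrightarrow> \<xi> i \<in> carrier_vec (m * n)"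
      and XX: "X = mat_sum (m * n) {..<r} (\<lambda>i. rank_one (\<xi> i))"
      and sn: "schmidt_number m n X = Max (insert 1 ((\<lambda>i. schmidt_rank m n (\<xi> i)) ` {..<r}))"
      unfolding P_def by blast
    have "schmidt_rank m n (\<xi> i) \<le> k" if "i < r" for i
    proof -
      have "schmidt_rank m n (\<xi> i) \<le> schmidt_number m n X"
        unfolding sn using that by (intro Max_ge) auto
      then show ?thesis using X by simp
    qed
    then have F: "\<forall>f\<in>set (map (\<lambda>i p. \<xi> i $ pair_index n p) [0..<r]). tensor_rank_le {..<m} {..<n} k f"
      using schmidt_rank_le_iff[OF car] by auto
    have "tensor_kernel n X p q = dyads (map (\<lambda>i p. \<xi> i $ pair_index n p) [0..<r]) p q" if "p \<in> grid m n" "q \<in> grid m n" for p q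
      unfolding XX kernel_mat_sum[OF that] dyads_def
      using kernel_rank_one[OF car that] by (simp add: sum_list_sum_nth atLeast0LessThan)
    then show "schmidt_number_le k m n X"
      unfolding schmidt_number_le_def using F XX by (metis mat_sum_carrier)
  qed
qed

text \<open>
  Decomposing the factors \<open>A\<^sub>l\<close> and \<open>B\<^sub>l\<close> of a separable matrix into rank-one matrices yields product
  vectors. Conversely \<open>|a \<otimes> b\<rangle>\<langle>a \<otimes> b| = |a\<rangle>\<langle>a| \<otimes> |b\<rangle>\<langle>b|\<close>.
\<close>

theorem separable_iff_schmidt_number_le_1: "separable m n X \<longleftrightarrow> schmidt_number_le 1 m n X"
proof
  assume "separable m n X"
  then obtain r :: nat and A B where AB: "\<And>l. l < r \<Longrightarrow> pos_semidef m (A l)" "\<And>l. l < r \<Longrightarrow> pos_semidef n (B l)"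
    and X: "X = mat_sum (m * n) {..<r} (\<lambda>l. tensor_mat (A l) (B l))"
    unfolding separable_def by blast
  have "\<exists>G. \<forall>i<d. \<forall>j<d. Y $$ (i, j) = dyads G i j" if "pos_semidef d Y" for d Y
    using psd_imp_dyads[of "{..<d}" "\<lambda>a b. Y $$ (a, b)"] that by (auto simp: pos_semidef_iff_psd)
  then have exA: "\<forall>l. \<exists>G. l < r \<longrightarrow> (\<forall>i<m. \<forall>j<m. A l $$ (i, j) = dyads G i j)"
    and exB: "\<forall>l. \<exists>G. l < r \<longrightarrow> (\<forall>i<n. \<forall>j<n. B l $$ (i, j) = dyads G i j)"
    using AB by blast+
  obtain FA where FA': "\<forall>l. l < r \<longrightarrow> (\<forall>i<m. \<forall>j<m. A l $$ (i, j) = dyads (FA l) i j)"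
    using choice[OF exA] by (rule exE)
  obtain FB where FB': "\<forall>l. l < r \<longrightarrow> (\<forall>i<n. \<forall>j<n. B l $$ (i, j) = dyads (FB l) i j)"
    using choice[OF exB] by (rule exE)
  have FA: "A l $$ (i, j) = dyads (FA l) i j" if "l < r" "i < m" "j < m" for l i j
    using FA' that by blast
  have FB: "B l $$ (i, j) = dyads (FB l) i j" if "l < r" "i < n" "j < n" for l i j
    using FB' that by blast
  define pr where "pr = (\<lambda>(f :: nat \<Rightarrow> complex, g :: nat \<Rightarrow> complex) (i, x). f i * g x)"
  have pr: "dyads (map pr (List.product F G)) (i, x) (j, y) = dyads F i j * dyads G x y" for F G i j x y
  proof (induction F)
    case (Cons f F)
    have "dyads (map pr (map (Pair f) G)) (i, x) (j, y) = f i * cnj (f j) * dyads G x y"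
      by (induction G) (simp_all add: pr_def algebra_simps)
    then show ?case using Cons by (simp add: algebra_simps)
  qed simp
  define F where "F = concat (map (\<lambda>l. map pr (List.product (FA l) (FB l))) [0..<r])"
  have "tensor_rank_le {..<m} {..<n} 1 f" if "f \<in> set F" for f
  proof -
    obtain g h where "f = pr (g, h)" using \<open>f \<in> set F\<close> by (auto simp: F_def)
    then show ?thesis
      unfolding tensor_rank_le_def
      by (intro exI[of _ "\<lambda>_. g"] exI[of _ "\<lambda>_. h"]) (simp add: pr_def)
  qed
  moreover have "tensor_kernel n X p q = dyads F p q" if pq: "p \<in> grid m n" "q \<in> grid m n" for p q
  proof -
    obtain i x j y where e: "p = (i, x)" "q = (j, y)" and l: "i < m" "x < n" "j < m" "y < n"
      using pq by auto
    have "tensor_kernel n X p q = (\<Sum>l<r. tensor_kernel n (tensor_mat (A l) (B l)) (i, x) (j, y))"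
      unfolding X e by (rule kernel_mat_sum) (use l in auto)
    also have "\<dots> = (\<Sum>l<r. dyads (FA l) i j * dyads (FB l) x y)"
    proof (intro sum.cong refl)
      fix k assume "k \<in> {..<r}"
      then have k: "k < r" by simp
      then show "tensor_kernel n (tensor_mat (A k) (B k)) (i, x) (j, y) = dyads (FA k) i j * dyads (FB k) x y"
        using AB[OF k] FA[OF k l(1,3)] FB[OF k l(2,4)] l
        by (subst kernel_tensor_mat[of _ m]) (auto simp: pos_semidef_def)
    qed
    also have "\<dots> = dyads F p q"
      by (simp add: F_def e dyads_concat comp_def pr sum_list_sum_nth atLeast0LessThan)
    finally show ?thesis .
  qed
  ultimately show "schmidt_number_le 1 m n X"
    unfolding schmidt_number_le_def X by (meson mat_sum_carrier)
next
  assume X: "schmidt_number_le 1 m n X"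
  then obtain F where F: "\<And>f. f \<in> set F \<Longrightarrow> tensor_rank_le {..<m} {..<n} 1 f"
    and K: "\<And>p q. p \<in> grid m n \<Longrightarrow> q \<in> grid m n \<Longrightarrow> tensor_kernel n X p q = dyads F p q"
    and car: "X \<in> carrier_mat (m * n) (m * n)"
    unfolding schmidt_number_le_def by blast
  have "\<forall>l<length F. \<exists>a b. \<forall>i<m. \<forall>x<n. (F ! l) (i, x) = a i * b x"
    using F[OF nth_mem] by (fastforce simp: tensor_rank_le_def)
  then obtain a b where ab: "\<And>l i x. l < length F \<Longrightarrow> i < m \<Longrightarrow> x < n \<Longrightarrow> (F ! l) (i, x) = a l i * b l x"
    by metis
  define dy where "dy = (\<lambda>d (c :: nat \<Rightarrow> complex). mat d d (\<lambda>(i, j). c i * cnj (c j)))"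
  have dy: "pos_semidef d (dy d c)" for d c
    unfolding pos_semidef_iff_psd
    using psd_dyads[of "{..<d}" "[c]"] psd_cong[of "{..<d}" "\<lambda>a b. dy d c $$ (a, b)" "dyads [c]"]
    by (simp add: dy_def)
  have "X = mat_sum (m * n) {..<length F} (\<lambda>l. tensor_mat (dy m (a l)) (dy n (b l)))"
  proof (subst mat_eq_iff_kernel[OF car mat_sum_carrier], intro ballI)
    fix p q assume pq: "p \<in> grid m n" "q \<in> grid m n"
    obtain i x j y where e: "p = (i, x)" "q = (j, y)" and l: "i < m" "x < n" "j < m" "y < n"
      using pq by auto
    have "tensor_kernel n (tensor_mat (dy m (a k)) (dy n (b k))) p q = (F ! k) p * cnj ((F ! k) q)" if "k < length F" for k
      unfolding e using l that by (subst kernel_tensor_mat[of _ m]) (auto simp: dy_def ab)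
    then show "tensor_kernel n X p q = tensor_kernel n (mat_sum (m * n) {..<length F} (\<lambda>l. tensor_mat (dy m (a l)) (dy n (b l)))) p q"
      unfolding K[OF pq] kernel_mat_sum[OF pq]
      by (simp add: dyads_def sum_list_sum_nth atLeast0LessThan)
  qed
  then show "separable m n X"
    unfolding separable_def
    by (intro conjI schmidt_number_le_psd[OF X] exI[of _ "length F"]
        exI[of _ "\<lambda>l. dy m (a l)"] exI[of _ "\<lambda>l. dy n (b l)"] allI impI dy)
qed

section \<open>Completely positive maps and their Choi matrices\<close>

lemma linear_map_id_tensor:
  assumes lin: "linear_map d1 d2 \<Phi>"
  shows "linear_map (k * d1) (k * d2) (id_tensor k d1 d2 \<Phi>)"
  unfolding linear_map_def
proof (intro conjI ballI allI)
  fix X Y :: "complex mat" and c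
  assume X: "X \<in> carrier_mat (k * d1) (k * d1)" and Y: "Y \<in> carrier_mat (k * d1) (k * d1)"
  have add: "tensor_kernel d1 (X + Y) (i, x) (j, y) = tensor_kernel d1 X (i, x) (j, y) + tensor_kernel d1 Y (i, x) (j, y)"
    if "i < k" "x < d1" "j < k" "y < d1" for i x j y
    using X Y pair_index_less[OF that(1,2)] pair_index_less[OF that(3,4)] by (simp add: tensor_kernel_def pair_index_def)
  have "tensor_kernel d2 (id_tensor k d1 d2 \<Phi> (X + Y)) p q = tensor_kernel d2 (id_tensor k d1 d2 \<Phi> X + id_tensor k d1 d2 \<Phi> Y) p q"
    if pq: "p \<in> grid k d2" "q \<in> grid k d2" for p q
  proof -
    obtain i a j b where e: "p = (i, a)" "q = (j, b)" and l: "i < k" "a < d2" "j < k" "b < d2"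
      using pq by auto
    have "tensor_kernel d2 (id_tensor k d1 d2 \<Phi> X + id_tensor k d1 d2 \<Phi> Y) p q
      = tensor_kernel d2 (id_tensor k d1 d2 \<Phi> X) p q + tensor_kernel d2 (id_tensor k d1 d2 \<Phi> Y) p q"
      using carrier_matD[OF id_tensor_carrier] pair_index_less[OF l(1,2)] pair_index_less[OF l(3,4)]
      by (simp add: tensor_kernel_def e pair_index_def)
    then show ?thesis
      using l by (simp add: e kernel_id_tensor_choi[OF lin] add distrib_right sum.distrib)
  qed
  then show "id_tensor k d1 d2 \<Phi> (X + Y) = id_tensor k d1 d2 \<Phi> X + id_tensor k d1 d2 \<Phi> Y"
    by (subst mat_eq_iff_kernel[of _ k d2]) auto
next
  fix X :: "complex mat" and c
  assume X: "X \<in> carrier_mat (k * d1) (k * d1)"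
  have smult: "tensor_kernel d1 (c \<cdot>\<^sub>m X) (i, x) (j, y) = c * tensor_kernel d1 X (i, x) (j, y)"
    if "i < k" "x < d1" "j < k" "y < d1" for i x j y
    using X pair_index_less[OF that(1,2)] pair_index_less[OF that(3,4)] by (simp add: tensor_kernel_def pair_index_def)
  have "tensor_kernel d2 (id_tensor k d1 d2 \<Phi> (c \<cdot>\<^sub>m X)) p q = tensor_kernel d2 (c \<cdot>\<^sub>m id_tensor k d1 d2 \<Phi> X) p q"
    if pq: "p \<in> grid k d2" "q \<in> grid k d2" for p q
  proof -
    obtain i a j b where e: "p = (i, a)" "q = (j, b)" and l: "i < k" "a < d2" "j < k" "b < d2"
      using pq by auto
    have "tensor_kernel d2 (c \<cdot>\<^sub>m id_tensor k d1 d2 \<Phi> X) p q = c * tensor_kernel d2 (id_tensor k d1 d2 \<Phi> X) p q"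
      using carrier_matD[OF id_tensor_carrier] pair_index_less[OF l(1,2)] pair_index_less[OF l(3,4)]
      by (simp add: tensor_kernel_def e pair_index_def)
    then show ?thesis
      using l by (simp add: e kernel_id_tensor_choi[OF lin] smult sum_distrib_left mult.assoc)
  qed
  then show "id_tensor k d1 d2 \<Phi> (c \<cdot>\<^sub>m X) = c \<cdot>\<^sub>m id_tensor k d1 d2 \<Phi> X"
    by (subst mat_eq_iff_kernel[of _ k d2]) auto
qed simp

text \<open>
  Both bounds come from the rank of a product of matrices, applied to the vectors \<open>contract d1 h f\<close>. The
  bound by \<open>k\<close> shows that a separable Choi matrix makes the map entanglement breaking, the bound
  by \<open>l\<close> that local operations do not increase Schmidt numbers.
\<close>

lemma schmidt_number_le_id_tensor:
  assumes lin: "linear_map d1 d2 \<Phi>"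
    and C: "schmidt_number_le k d1 d2 (choi_matrix d1 d2 \<Phi>)" and X: "schmidt_number_le l n d1 X"
  shows "schmidt_number_le (min k l) n d2 (id_tensor n d1 d2 \<Phi> X)"
proof -
  obtain F where F: "\<And>f. f \<in> set F \<Longrightarrow> tensor_rank_le {..<d1} {..<d2} k f"
    and CF: "\<And>p q. p \<in> grid d1 d2 \<Longrightarrow> q \<in> grid d1 d2 \<Longrightarrow> tensor_kernel d2 (choi_matrix d1 d2 \<Phi>) p q = dyads F p q"
    using C unfolding schmidt_number_le_def by blast
  obtain H where H: "\<And>h. h \<in> set H \<Longrightarrow> tensor_rank_le {..<n} {..<d1} l h"
    and XH: "\<And>p q. p \<in> grid n d1 \<Longrightarrow> q \<in> grid n d1 \<Longrightarrow> tensor_kernel d1 X p q = dyads H p q"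
    using X unfolding schmidt_number_le_def by blast
  define G where "G = concat (map (\<lambda>h. map (contract d1 h) F) H)"
  have "tensor_rank_le {..<n} {..<d2} (min k l) g" if g: "g \<in> set G" for g
  proof -
    obtain f h where "g = contract d1 h f" "f \<in> set F" "h \<in> set H"
      using g by (auto simp: G_def)
    then show ?thesis
      using tensor_rank_contract_left[OF H] tensor_rank_contract_right[OF F] by (auto simp: min_def)
  qed
  moreover have "tensor_kernel d2 (id_tensor n d1 d2 \<Phi> X) p q = dyads G p q"
    if pq: "p \<in> grid n d2" "q \<in> grid n d2" for p q
  proof -
    obtain i a j b where e: "p = (i, a)" "q = (j, b)" and l: "i < n" "a < d2" "j < n" "b < d2"
      using pq by auto
    have "tensor_kernel d2 (id_tensor n d1 d2 \<Phi> X) p q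
      = (\<Sum>x<d1. \<Sum>y<d1. dyads H (i, x) (j, y) * dyads F (x, a) (y, b))"
      using l by (simp add: e kernel_id_tensor_choi[OF lin] XH CF)
    also have "\<dots> = dyads G p q" by (simp only: contract_dyads G_def e)
    finally show ?thesis .
  qed
  ultimately show ?thesis
    unfolding schmidt_number_le_def by (metis id_tensor_carrier)
qed

text \<open>
  The unnormalised maximally entangled state \<open>|\<Omega>\<rangle>\<langle>\<Omega>|\<close> with
  \<open>\<Omega> = (\<Sum>i<d. e\<^sub>i \<otimes> e\<^sub>i)\<close>.
\<close>

definition max_entangled :: "nat \<Rightarrow> complex mat" where
  "max_entangled d = mat (d * d) (d * d)
     (\<lambda>(s, t). if s div d = s mod d \<and> t div d = t mod d then 1 else 0)"

lemma pos_semidef_max_entangled: "pos_semidef (d * d) (max_entangled d)"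
proof (rule pos_semidefI_dyads[where F = "[\<lambda>(i, x). if i = x then 1 else 0]"])
  show "max_entangled d \<in> carrier_mat (d * d) (d * d)" by (simp add: max_entangled_def)
  fix p q assume "p \<in> grid d d" "q \<in> grid d d"
  then show "tensor_kernel d (max_entangled d) p q = dyads [\<lambda>(i, x). if i = x then 1 else 0] p q"
    using pair_index_less[of "fst p" d "snd p" d] pair_index_less[of "fst q" d "snd q" d]
    by (auto simp: tensor_kernel_def max_entangled_def pair_index_def)
qed

lemma choi_matrix_eq_id_tensor: "choi_matrix d1 d2 \<Phi> = id_tensor d1 d1 d2 \<Phi> (max_entangled d1)"
proof -
  have "block d1 (max_entangled d1) i j = mat_unit d1 i j" if "i < d1" "j < d1" for i j
    using that pair_index_less[of i d1 _ d1] pair_index_less[of j d1 _ d1]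
    by (intro eq_matI) (auto simp: block_def mat_unit_def max_entangled_def)
  then show ?thesis
    unfolding choi_matrix_def id_tensor_def mat_sum_def
    by (intro arg_cong2[where f = "mat (d1 * d2)"] cong_mat refl) (auto intro!: sum.cong)
qed

lemma completely_positive_id_tensor:
  assumes "completely_positive d1 d2 \<Phi>" "pos_semidef (k * d1) X" "1 \<le> k"
  shows "pos_semidef (k * d2) (id_tensor k d1 d2 \<Phi> X)"
  using assms by (auto simp: completely_positive_def k_positive_def positive_map_def)

lemma completely_positive_linear: "completely_positive d1 d2 \<Phi> \<Longrightarrow> linear_map d1 d2 \<Phi>"
  by (auto simp: completely_positive_def k_positive_def)

lemma completely_positive_choi:
  assumes "completely_positive d1 d2 \<Phi>" "1 \<le> d1"
  shows "pos_semidef (d1 * d2) (choi_matrix d1 d2 \<Phi>)"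
  unfolding choi_matrix_eq_id_tensor
  by (rule completely_positive_id_tensor[OF assms(1) pos_semidef_max_entangled assms(2)])

text \<open>
  The sufficient direction of Choi's criterion: the decomposition of the Choi matrix gives one of
  \<open>(id \<otimes> \<Phi>) X\<close> for every positive semidefinite \<open>X\<close>.
\<close>

lemma completely_positiveI_choi:
  assumes lin: "linear_map d1 d2 \<Phi>" and C: "pos_semidef (d1 * d2) (choi_matrix d1 d2 \<Phi>)"
  shows "completely_positive d1 d2 \<Phi>"
  unfolding completely_positive_def k_positive_def positive_map_def
  using lin linear_map_id_tensor[OF lin]
    schmidt_number_le_psd[OF schmidt_number_le_id_tensor[OF lin schmidt_number_le_dim[OF C] schmidt_number_le_dim]]
  by blast

lemma entanglement_breaking_iff:
  assumes lin: "linear_map d1 d2 \<Phi>" and d1: "1 \<le> d1"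
  shows "entanglement_breaking d1 d2 \<Phi> \<longleftrightarrow> schmidt_number_le 1 d1 d2 (choi_matrix d1 d2 \<Phi>)"
proof
  assume "entanglement_breaking d1 d2 \<Phi>"
  then show "schmidt_number_le 1 d1 d2 (choi_matrix d1 d2 \<Phi>)"
    using d1 pos_semidef_max_entangled
    by (simp add: choi_matrix_eq_id_tensor entanglement_breaking_def separable_iff_schmidt_number_le_1)
next
  assume C: "schmidt_number_le 1 d1 d2 (choi_matrix d1 d2 \<Phi>)"
  have "schmidt_number_le 1 n d2 (id_tensor n d1 d2 \<Phi> X)" if "pos_semidef (n * d1) X" for n X
    using schmidt_number_le_id_tensor[OF lin C schmidt_number_le_dim[OF that]]
    by (rule schmidt_number_le_mono) simp
  then show "entanglement_breaking d1 d2 \<Phi>"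
    using lin by (simp add: entanglement_breaking_def separable_iff_schmidt_number_le_1)
qed

lemma choi_matrix_comp:
  assumes "linear_map m d1 \<Psi>"
  shows "choi_matrix m d2 (\<Phi> \<circ> \<Psi>) = id_tensor m d1 d2 \<Phi> (choi_matrix m d1 \<Psi>)"
proof -
  have "block d1 (choi_matrix m d1 \<Psi>) i j = \<Psi> (mat_unit m i j)" if "i < m" "j < m" for i j
  proof (rule eq_matI)
    fix a b assume "a < dim_row (\<Psi> (mat_unit m i j))" "b < dim_col (\<Psi> (mat_unit m i j))"
    then have "a < d1" "b < d1" using linear_map_carrier[OF assms mat_unit_carrier, of i j] by auto
    then show "block d1 (choi_matrix m d1 \<Psi>) i j $$ (a, b) = \<Psi> (mat_unit m i j) $$ (a, b)"
      using kernel_choi_matrix[OF assms that] by (simp add: block_def tensor_kernel_def pair_index_def)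
  qed (use linear_map_carrier[OF assms mat_unit_carrier, of i j] in \<open>auto simp: block_def\<close>)
  then show ?thesis
    unfolding choi_matrix_def[of m d2] id_tensor_def mat_sum_def
    by (intro arg_cong2[where f = "mat (m * d2)"] cong_mat refl) (auto intro!: sum.cong)
qed

text \<open>
  The inverse of the Choi correspondence.
\<close>

definition map_of_choi :: "nat \<Rightarrow> nat \<Rightarrow> complex mat \<Rightarrow> complex mat \<Rightarrow> complex mat" where
  "map_of_choi d1 d2 C X = mat d2 d2 (\<lambda>(a, b). \<Sum>i<d1. \<Sum>j<d1. X $$ (i, j) * tensor_kernel d2 C (i, a) (j, b))"

lemma linear_map_of_choi: "linear_map d1 d2 (map_of_choi d1 d2 C)"
  unfolding linear_map_def map_of_choi_def
  by (auto intro!: eq_matI simp: distrib_right sum.distrib sum_distrib_left mult.assoc)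

lemma choi_matrix_map_of_choi:
  assumes "C \<in> carrier_mat (d1 * d2) (d1 * d2)"
  shows "choi_matrix d1 d2 (map_of_choi d1 d2 C) = C"
proof (subst mat_eq_iff_kernel[OF choi_matrix_carrier assms], intro ballI)
  fix p q assume pq: "p \<in> grid d1 d2" "q \<in> grid d1 d2"
  obtain i a j b where e: "p = (i, a)" "q = (j, b)" and l: "i < d1" "a < d2" "j < d1" "b < d2"
    using pq by auto
  have "tensor_kernel d2 (choi_matrix d1 d2 (map_of_choi d1 d2 C)) p q
    = (\<Sum>x<d1. \<Sum>y<d1. mat_unit d1 i j $$ (x, y) * tensor_kernel d2 C (x, a) (y, b))"
    using l by (simp add: e kernel_choi_matrix[OF linear_map_of_choi] map_of_choi_def)
  also have "\<dots> = (\<Sum>x<d1. \<Sum>y<d1. if y = j then if x = i then tensor_kernel d2 C (x, a) (y, b) else 0 else 0)"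
    by (intro sum.cong refl) (auto simp: mat_unit_def)
  also have "\<dots> = tensor_kernel d2 C p q" using l by (simp add: e)
  finally show "tensor_kernel d2 (choi_matrix d1 d2 (map_of_choi d1 d2 C)) p q = tensor_kernel d2 C p q" .
qed

lemma rank_le_row_dim:
  fixes V :: "complex mat"
  assumes "V \<in> carrier_mat n nc"
  shows "vec_space.rank n V \<le> n"
proof -
  interpret vec_space "TYPE(complex)" n .
  obtain S where "maximal S (\<lambda>T. T \<subseteq> set (cols V) \<and> lin_indpt T)"
    using maximal_exists[of "\<lambda>T. T \<subseteq> set (cols V) \<and> lin_indpt T" "card (set (cols V))" "{}"]
    by (metis (no_types, lifting) List.finite_set card_mono empty_iff empty_subsetI finite_lin_indpt2 rev_finite_subset)
  then have "rank V = card S" and S: "S \<subseteq> set (cols V)" "lin_indpt S"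
    using rank_card_indpt[OF assms] by (auto simp: maximal_def)
  moreover have "S \<subseteq> carrier_vec n"
    using S(1) cols_dim[of V] assms by auto
  ultimately show ?thesis
    using li_le_dim(2)[OF fin_dim] dim_is_n by simp
qed

text \<open>
  The vectors of a decomposition of the Choi matrix, reshaped and conjugated, are Kraus operators. Their rank is
  at most the number \<open>d1\<close> of their rows.
\<close>

lemma completely_positive_kraus:
  assumes cp: "completely_positive d1 d2 \<Phi>" and d1: "1 \<le> d1"
  shows "k_partially_entanglement_breaking d1 d1 d2 \<Phi>"
proof -
  have lin: "linear_map d1 d2 \<Phi>" using cp by (rule completely_positive_linear)
  obtain F where F: "\<And>p q. p \<in> grid d1 d2 \<Longrightarrow> q \<in> grid d1 d2 \<Longrightarrow> tensor_kernel d2 (choi_matrix d1 d2 \<Phi>) p q = dyads F p q"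
    using pos_semidef_dyads[OF completely_positive_choi[OF cp d1]] by blast
  define V where "V l = mat d1 d2 (\<lambda>p. cnj ((F ! l) p))" for l
  have V: "V l \<in> carrier_mat d1 d2" for l by (simp add: V_def)
  have "\<Phi> X = mat_sum d2 {..<length F} (\<lambda>l. mat_adjoint (V l) * X * V l)" if X: "X \<in> carrier_mat d1 d1" for X
  proof (rule eq_matI)
    fix a b assume "a < dim_row (mat_sum d2 {..<length F} (\<lambda>l. mat_adjoint (V l) * X * V l))"
      "b < dim_col (mat_sum d2 {..<length F} (\<lambda>l. mat_adjoint (V l) * X * V l))"
    then have ab: "a < d2" "b < d2" by (simp_all add: mat_sum_def)
    have adj: "mat_adjoint (V l) = mat d2 d1 (\<lambda>(a, i). (F ! l) (i, a))" for l
      by (intro eq_matI) (auto simp: mat_adjoint_def V_def mat_of_rows_def)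
    have entry: "(mat_adjoint (V l) * X * V l) $$ (a, b)
      = (\<Sum>i<d1. \<Sum>j<d1. X $$ (i, j) * ((F ! l) (i, a) * cnj ((F ! l) (j, b))))" for l
    proof -
      have "(mat_adjoint (V l) * X * V l) $$ (a, b)
        = (\<Sum>j<d1. (\<Sum>i<d1. (F ! l) (i, a) * X $$ (i, j)) * cnj ((F ! l) (j, b)))"
        unfolding adj using X ab by (simp add: V_def scalar_prod_def atLeast0LessThan)
      also have "\<dots> = (\<Sum>j<d1. \<Sum>i<d1. X $$ (i, j) * ((F ! l) (i, a) * cnj ((F ! l) (j, b))))"
        by (simp add: sum_distrib_left sum_distrib_right algebra_simps)
      also have "\<dots> = (\<Sum>i<d1. \<Sum>j<d1. X $$ (i, j) * ((F ! l) (i, a) * cnj ((F ! l) (j, b))))"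
        by (rule sum.swap)
      finally show ?thesis .
    qed
    have "\<Phi> X $$ (a, b) = (\<Sum>i<d1. \<Sum>j<d1. \<Sum>l<length F. X $$ (i, j) * ((F ! l) (i, a) * cnj ((F ! l) (j, b))))"
      using ab by (simp add: linear_map_index[OF lin X] F dyads_def sum_list_sum_nth atLeast0LessThan sum_distrib_left)
    also have "\<dots> = (\<Sum>i<d1. \<Sum>l<length F. \<Sum>j<d1. X $$ (i, j) * ((F ! l) (i, a) * cnj ((F ! l) (j, b))))"
      by (intro sum.cong refl sum.swap)
    also have "\<dots> = (\<Sum>l<length F. \<Sum>i<d1. \<Sum>j<d1. X $$ (i, j) * ((F ! l) (i, a) * cnj ((F ! l) (j, b))))"
      by (rule sum.swap)
    also have "\<dots> = mat_sum d2 {..<length F} (\<lambda>l. mat_adjoint (V l) * X * V l) $$ (a, b)"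
      by (simp only: mat_sum_index[OF ab] entry)
    finally show "\<Phi> X $$ (a, b) = mat_sum d2 {..<length F} (\<lambda>l. mat_adjoint (V l) * X * V l) $$ (a, b)" .
  qed (use linear_map_carrier[OF lin X] in \<open>auto simp: mat_sum_def\<close>)
  then show ?thesis
    unfolding k_partially_entanglement_breaking_def using cp V rank_le_row_dim[OF V] by blast
qed

lemma k_partially_entanglement_breaking_mono:
  assumes "k_partially_entanglement_breaking k d1 d2 \<Phi>" "k \<le> k'"
  shows "k_partially_entanglement_breaking k' d1 d2 \<Phi>"
proof -
  obtain r :: nat and V where V: "\<forall>i<r. V i \<in> carrier_mat d1 d2 \<and> vec_space.rank d1 (V i) \<le> k"
    and eq: "\<forall>X\<in>carrier_mat d1 d1. \<Phi> X = mat_sum d2 {..<r} (\<lambda>i. mat_adjoint (V i) * X * V i)"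
    using assms(1) unfolding k_partially_entanglement_breaking_def by blast
  have "\<forall>i<r. V i \<in> carrier_mat d1 d2 \<and> vec_space.rank d1 (V i) \<le> k'"
    using V assms(2) by (blast intro: le_trans)
  then show ?thesis
    using assms(1) eq unfolding k_partially_entanglement_breaking_def by blast
qed

section \<open>Lowering the Schmidt number\<close>

text \<open>
  In the proof, \<open>K\<close> is the kernel of \<open>(id\<^sub>k \<otimes> \<Phi>) |\<zeta>\<rangle>\<langle>\<zeta>|\<close> with
  \<open>\<zeta> = (\<Sum>l<k. e\<^sub>l \<otimes> b\<^sub>l)\<close>. It does not depend on \<open>k\<close>, so its restriction to the first two indices
  is the same construction for \<open>k = 2\<close>, to which the hypothesis on \<open>\<Phi>\<close> applies.
\<close>

theorem two_entanglement_breaking_lowers_schmidt_number: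
  assumes cp: "completely_positive d1 d2 \<Phi>" and eb: "k_entanglement_breaking 2 d1 d2 \<Phi>"
    and k: "2 \<le> k" and X: "schmidt_number_le k m d1 X"
  shows "schmidt_number_le (k - 1) m d2 (id_tensor m d1 d2 \<Phi> X)"
proof -
  have lin: "linear_map d1 d2 \<Phi>" using cp by (rule completely_positive_linear)
  let ?C = "tensor_kernel d2 (choi_matrix d1 d2 \<Phi>)"
  obtain F where F: "\<And>f. f \<in> set F \<Longrightarrow> tensor_rank_le {..<m} {..<d1} k f"
    and XF: "\<And>p q. p \<in> grid m d1 \<Longrightarrow> q \<in> grid m d1 \<Longrightarrow> tensor_kernel d1 X p q = dyads F p q"
    using X unfolding schmidt_number_le_def by blast
  have "\<exists>G. (\<forall>g\<in>set G. tensor_rank_le {..<m} {..<d2} (k - 1) g) \<and>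
      (\<forall>i<m. \<forall>j<m. \<forall>s<d2. \<forall>t<d2. (\<Sum>x<d1. \<Sum>y<d1. f (i, x) * cnj (f (j, y)) * ?C (x, s) (y, t)) = dyads G (i, s) (j, t))"
    if f: "tensor_rank_le {..<m} {..<d1} k f" for f
  proof -
    obtain a b where ab: "\<And>i x. i < m \<Longrightarrow> x < d1 \<Longrightarrow> f (i, x) = (\<Sum>l<k. a l i * b l x)"
      using f unfolding tensor_rank_le_def by auto
    define Z where "Z = (\<lambda>n. mat (n * d1) (n * d1) (\<lambda>(s, t). b (s div d1) (s mod d1) * cnj (b (t div d1) (t mod d1))))"
    have kerZ: "tensor_kernel d1 (Z n) (i, x) (j, y) = b i x * cnj (b j y)" if "i < n" "j < n" "x < d1" "y < d1" for n i j x y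
      using that pair_index_less[of i n x d1] pair_index_less[of j n y d1] by (simp add: Z_def tensor_kernel_def pair_index_def)
    have Z: "pos_semidef (n * d1) (Z n)" for n
    proof (rule pos_semidefI_dyads[where F = "[\<lambda>(i, x). b i x]"])
      show "Z n \<in> carrier_mat (n * d1) (n * d1)" by (simp add: Z_def)
      fix p q assume "p \<in> grid n d1" "q \<in> grid n d1"
      then show "tensor_kernel d1 (Z n) p q = dyads [\<lambda>(i, x). b i x] p q" by (auto simp: kerZ)
    qed
    define K where "K = (\<lambda>(l, s) (l', t). \<Sum>x<d1. \<Sum>y<d1. b l x * cnj (b l' y) * ?C (x, s) (y, t))"
    have kerK: "tensor_kernel d2 (id_tensor n d1 d2 \<Phi> (Z n)) p q = K p q" if "p \<in> grid n d2" "q \<in> grid n d2" for n p q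
      using that by (auto simp: kernel_id_tensor_choi[OF lin] kerZ K_def)
    have "pos_semidef (k * d2) (id_tensor k d1 d2 \<Phi> (Z k))"
      using k by (intro completely_positive_id_tensor[OF cp Z]) simp
    then have psdK: "psd (grid k d2) K"
      using psd_cong[of "grid k d2" "tensor_kernel d2 (id_tensor k d1 d2 \<Phi> (Z k))" K] kerK
      by (simp add: pos_semidef_iff_kernel)
    have "schmidt_number_le 1 2 d2 (id_tensor 2 d1 d2 \<Phi> (Z 2))"
      using eb Z[of 2] by (simp add: k_entanglement_breaking_def separable_iff_schmidt_number_le_1)
    then obtain W where W: "\<forall>w\<in>set W. tensor_rank_le {..<2} {..<d2} 1 w"
      and KW': "\<forall>p\<in>grid 2 d2. \<forall>q\<in>grid 2 d2. tensor_kernel d2 (id_tensor 2 d1 d2 \<Phi> (Z 2)) p q = dyads W p q"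
      unfolding schmidt_number_le_def by (elim conjE exE)
    have KW: "K p q = dyads W p q" if "p \<in> grid 2 d2" "q \<in> grid 2 d2" for p q
      using KW' kerK[OF that] that by metis
    have sub: "grid 2 d2 \<subseteq> grid k d2" using k by auto
    have fin: "finite (grid k d2)" by simp
    have "\<exists>G. (\<forall>p\<in>grid k d2. \<forall>q\<in>grid k d2. K p q = dyads G p q) \<and>
      (\<forall>g\<in>set G. (\<forall>p\<in>grid 2 d2. g p = 0) \<or> (\<exists>w\<in>set W. \<forall>p\<in>grid 2 d2. g p = w p))"
      by (rule psd_dyads_lift[OF fin sub psdK]) (rule KW)
    then obtain G where KG': "\<forall>p\<in>grid k d2. \<forall>q\<in>grid k d2. K p q = dyads G p q"
      and GW: "\<forall>g\<in>set G. (\<forall>p\<in>grid 2 d2. g p = 0) \<or> (\<exists>w\<in>set W. \<forall>p\<in>grid 2 d2. g p = w p)"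
      by (elim conjE exE)
    have KG: "K (l, s) (l', t) = dyads G (l, s) (l', t)" if "l < k" "l' < k" "s < d2" "t < d2" for l l' s t
      using KG' that by simp
    \<comment> \<open>The local map \<open>e\<^sub>l \<mapsto> a\<^sub>l\<close>.\<close>
    define L where "L = (\<lambda>g (i, s). \<Sum>l<k. a l i * g (l, s :: nat))"
    have "tensor_rank_le {..<m} {..<d2} (k - 1) (L g)" if g: "g \<in> set G" for g
    proof -
      have "\<exists>c e. \<forall>l<2. \<forall>s<d2. g (l, s) = c l * e s"
        using bspec[OF GW g]
      proof
        assume "\<forall>p\<in>grid 2 d2. g p = 0"
        then show ?thesis by (intro exI[of _ "\<lambda>_. 0"]) auto
      next
        assume "\<exists>w\<in>set W. \<forall>p\<in>grid 2 d2. g p = w p"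
        then obtain w where w: "w \<in> set W" "\<And>p. p \<in> grid 2 d2 \<Longrightarrow> g p = w p" by blast
        have "tensor_rank_le {..<2} {..<d2} 1 w" using W w(1) by blast
        then obtain c e where "\<forall>l\<in>{..<2}. \<forall>s\<in>{..<d2}. w (l, s) = (\<Sum>j<(1::nat). c j l * e j s)"
          unfolding tensor_rank_le_def by (elim exE)
        then show ?thesis
          using w(2) by (intro exI[of _ "c 0"] exI[of _ "e 0"]) auto
      qed
      then obtain c e where ce: "\<And>l s. l < 2 \<Longrightarrow> s < d2 \<Longrightarrow> g (l, s) = c l * e s" by blast
      \<comment> \<open>The terms of index 0 and 1 share the factor \<open>e\<close> and merge into one, stored at index 1.\<close>
      define a' where "a' = (\<lambda>j i. if j = 1 then a 0 i * c 0 + a 1 i * c 1 else a j i)"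
      define b' where "b' = (\<lambda>j s. if j = 1 then e s else g (j, s))"
      have "L g (i, s) = (\<Sum>j\<in>{1..<k}. a' j i * b' j s)" if "s < d2" for i s
      proof -
        have "{..<k} = insert 0 (insert 1 {2..<k})" "{1..<k} = insert 1 {2..<k}"
          using k by auto
        then have "L g (i, s) = a 0 i * g (0, s) + (a 1 i * g (1, s) + (\<Sum>l\<in>{2..<k}. a l i * g (l, s)))"
          and "(\<Sum>j\<in>{1..<k}. a' j i * b' j s) = a' 1 i * b' 1 s + (\<Sum>l\<in>{2..<k}. a' l i * b' l s)"
          by (simp_all add: L_def)
        moreover have "(\<Sum>l\<in>{2..<k}. a' l i * b' l s) = (\<Sum>l\<in>{2..<k}. a l i * g (l, s))"
          by (intro sum.cong) (auto simp: a'_def b'_def)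
        ultimately show ?thesis
          using ce[of 0 s] ce[of 1 s] that by (simp add: a'_def b'_def algebra_simps)
      qed
      then show ?thesis
        by (intro tensor_rank_leI[of "{1..<k}" _ _ _ _ a' b']) auto
    qed
    moreover have "(\<Sum>x<d1. \<Sum>y<d1. f (i, x) * cnj (f (j, y)) * ?C (x, s) (y, t)) = dyads (map L G) (i, s) (j, t)"
      if ij: "i < m" "j < m" "s < d2" "t < d2" for i j s t
    proof -
      have "(\<Sum>x<d1. \<Sum>y<d1. f (i, x) * cnj (f (j, y)) * ?C (x, s) (y, t))
        = (\<Sum>x<d1. \<Sum>y<d1. \<Sum>l<k. \<Sum>l'<k. a l i * cnj (a l' j) * (b l x * cnj (b l' y) * ?C (x, s) (y, t)))"
      proof (intro sum.cong refl)
        fix x y assume "x \<in> {..<d1}" "y \<in> {..<d1}"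
        then have "f (i, x) * cnj (f (j, y)) = (\<Sum>l<k. \<Sum>l'<k. (a l i * b l x) * cnj (a l' j * b l' y))"
          using ij by (simp only: lessThan_iff ab cnj_sum sum_product)
        then show "f (i, x) * cnj (f (j, y)) * ?C (x, s) (y, t)
          = (\<Sum>l<k. \<Sum>l'<k. a l i * cnj (a l' j) * (b l x * cnj (b l' y) * ?C (x, s) (y, t)))"
          by (simp add: sum_distrib_left sum_distrib_right algebra_simps)
      qed
      also have "\<dots> = (\<Sum>x<d1. \<Sum>l<k. \<Sum>l'<k. \<Sum>y<d1. a l i * cnj (a l' j) * (b l x * cnj (b l' y) * ?C (x, s) (y, t)))"
        by (simp add: sum.swap[of _ "{..<k}" "{..<d1}"])
      also have "\<dots> = (\<Sum>l<k. \<Sum>l'<k. \<Sum>x<d1. \<Sum>y<d1. a l i * cnj (a l' j) * (b l x * cnj (b l' y) * ?C (x, s) (y, t)))"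
        by (simp add: sum.swap[of _ "{..<k}" "{..<d1}"])
      also have "\<dots> = (\<Sum>l<k. \<Sum>l'<k. a l i * cnj (a l' j) * K (l, s) (l', t))"
        by (simp add: K_def sum_distrib_left)
      also have "\<dots> = (\<Sum>l<k. \<Sum>l'<k. a l i * cnj (a l' j) * dyads G (l, s) (l', t))"
        using ij by (simp add: KG)
      also have "\<dots> = dyads (map L G) (i, s) (j, t)"
      proof (induction G)
        case (Cons g G)
        have "(\<Sum>l<k. \<Sum>l'<k. a l i * cnj (a l' j) * (g (l, s) * cnj (g (l', t)))) = L g (i, s) * cnj (L g (j, t))"
          by (simp add: L_def sum_product algebra_simps)
        then show ?case using Cons by (simp add: distrib_left sum.distrib)
      qed simp
      finally show ?thesis .
    qed
    ultimately show ?thesis by (intro exI[of _ "map L G"]) auto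
  qed
  then have "\<forall>f\<in>set F. \<exists>G. (\<forall>g\<in>set G. tensor_rank_le {..<m} {..<d2} (k - 1) g) \<and>
      (\<forall>i<m. \<forall>j<m. \<forall>s<d2. \<forall>t<d2. (\<Sum>x<d1. \<Sum>y<d1. f (i, x) * cnj (f (j, y)) * ?C (x, s) (y, t)) = dyads G (i, s) (j, t))"
    using F by simp
  from bchoice[OF this] obtain G where G':
    "\<forall>f\<in>set F. (\<forall>g\<in>set (G f). tensor_rank_le {..<m} {..<d2} (k - 1) g) \<and>
      (\<forall>i<m. \<forall>j<m. \<forall>s<d2. \<forall>t<d2. (\<Sum>x<d1. \<Sum>y<d1. f (i, x) * cnj (f (j, y)) * ?C (x, s) (y, t)) = dyads (G f) (i, s) (j, t))"
    by (rule exE)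
  have GR: "tensor_rank_le {..<m} {..<d2} (k - 1) g" if "f \<in> set F" "g \<in> set (G f)" for f g
    using G' that by blast
  have G: "(\<Sum>x<d1. \<Sum>y<d1. f (i, x) * cnj (f (j, y)) * ?C (x, s) (y, t)) = dyads (G f) (i, s) (j, t)"
    if "f \<in> set F" "i < m" "j < m" "s < d2" "t < d2" for f i j s t
    using G' that by blast
  have "tensor_kernel d2 (id_tensor m d1 d2 \<Phi> X) p q = dyads (concat (map G F)) p q"
    if pq: "p \<in> grid m d2" "q \<in> grid m d2" for p q
  proof -
    obtain i s j t where e: "p = (i, s)" "q = (j, t)" and l: "i < m" "s < d2" "j < m" "t < d2"
      using pq by auto
    have "tensor_kernel d2 (id_tensor m d1 d2 \<Phi> X) p q = (\<Sum>x<d1. \<Sum>y<d1. dyads F (i, x) (j, y) * ?C (x, s) (y, t))"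
      using l by (simp add: e kernel_id_tensor_choi[OF lin] XF)
    also have "\<dots> = (\<Sum>f\<leftarrow>F. \<Sum>x<d1. \<Sum>y<d1. f (i, x) * cnj (f (j, y)) * ?C (x, s) (y, t))"
      by (induction F) (simp_all add: distrib_right sum.distrib)
    also have "\<dots> = (\<Sum>f\<leftarrow>F. dyads (G f) (i, s) (j, t))"
      using G l by (intro arg_cong[where f = sum_list] map_cong refl) blast
    finally show ?thesis by (simp add: e dyads_concat comp_def)
  qed
  then show ?thesis
    unfolding schmidt_number_le_def using GR
    by (intro conjI exI[of _ "concat (map G F)"]) auto
qed

theorem theorem5p2:
  fixes d1 d2 :: nat and \<Phi> :: "complex mat \<Rightarrow> complex mat"
  assumes "d1 > 1" and "d2 > 1" and "completely_positive d1 d2 \<Phi>"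
  shows
    "(k_entanglement_breaking 2 d1 d2 \<Phi> \<longleftrightarrow>
       (\<forall>m \<Psi>. 2 \<le> m \<and> m \<le> d2 \<and> completely_positive m d1 \<Psi> \<and> \<not> entanglement_breaking m d1 \<Psi>
          \<longrightarrow> schmidt_number_map m d2 (\<Phi> \<circ> \<Psi>) < schmidt_number_map m d1 \<Psi>)) \<and>
     (k_entanglement_breaking 2 d1 d2 \<Phi> \<longleftrightarrow>
       (\<forall>m \<Psi>. 2 \<le> m \<and> k_partially_entanglement_breaking d2 m d1 \<Psi> \<and> \<not> entanglement_breaking m d1 \<Psi>
          \<longrightarrow> schmidt_number_map m d2 (\<Phi> \<circ> \<Psi>) < schmidt_number_map m d1 \<Psi>)) \<and>
     (k_entanglement_breaking 2 d1 d2 \<Phi> \<longleftrightarrow>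
       (\<forall>\<Psi>. completely_positive 2 d1 \<Psi> \<and> \<not> entanglement_breaking 2 d1 \<Psi>
          \<longrightarrow> schmidt_number_map 2 d2 (\<Phi> \<circ> \<Psi>) < schmidt_number_map 2 d1 \<Psi>))"
    (is "(?i \<longleftrightarrow> ?ii) \<and> (?i \<longleftrightarrow> ?iii) \<and> (?i \<longleftrightarrow> ?iv)")
proof -
  note cp = assms(3)
  have lin: "linear_map d1 d2 \<Phi>" using cp by (rule completely_positive_linear)
  have drop: "schmidt_number_map m d2 (\<Phi> \<circ> \<Psi>) < schmidt_number_map m d1 \<Psi>"
    if i: ?i and m: "2 \<le> m" and \<Psi>: "completely_positive m d1 \<Psi>" "\<not> entanglement_breaking m d1 \<Psi>" for m \<Psi>
  proof -
    define k where "k = schmidt_number m d1 (choi_matrix m d1 \<Psi>)"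
    have linP: "linear_map m d1 \<Psi>" using \<Psi>(1) by (rule completely_positive_linear)
    have C: "pos_semidef (m * d1) (choi_matrix m d1 \<Psi>)"
      using completely_positive_choi[OF \<Psi>(1)] m by simp
    have "\<not> schmidt_number_le 1 m d1 (choi_matrix m d1 \<Psi>)"
      using entanglement_breaking_iff[OF linP] \<Psi>(2) m by simp
    then have k: "2 \<le> k"
      using schmidt_number_le_iff[of 1 m d1 "choi_matrix m d1 \<Psi>"] C by (simp add: k_def)
    then have "schmidt_number_le k m d1 (choi_matrix m d1 \<Psi>)"
      using schmidt_number_le_iff[of k m d1 "choi_matrix m d1 \<Psi>"] C by (simp add: k_def)
    then have "schmidt_number_le (k - 1) m d2 (choi_matrix m d2 (\<Phi> \<circ> \<Psi>))"
      unfolding choi_matrix_comp[OF linP]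
      by (rule two_entanglement_breaking_lowers_schmidt_number[OF cp i k])
    then have "schmidt_number m d2 (choi_matrix m d2 (\<Phi> \<circ> \<Psi>)) \<le> k - 1"
      using schmidt_number_le_iff[of "k - 1"] k by simp
    then show ?thesis using k by (simp add: schmidt_number_map_def k_def)
  qed
  have iv_i: ?i if iv: ?iv
  proof -
    have "schmidt_number_le 1 2 d2 (id_tensor 2 d1 d2 \<Phi> X)" if X: "pos_semidef (2 * d1) X" for X
    proof -
      define \<Psi> where "\<Psi> = map_of_choi 2 d1 X"
      have linP: "linear_map 2 d1 \<Psi>" unfolding \<Psi>_def by (rule linear_map_of_choi)
      have CP: "choi_matrix 2 d1 \<Psi> = X"
        unfolding \<Psi>_def using X by (intro choi_matrix_map_of_choi) (simp add: pos_semidef_iff_kernel)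
      have cpP: "completely_positive 2 d1 \<Psi>"
        using X by (intro completely_positiveI_choi[OF linP]) (simp add: CP)
      have C\<Phi>: "schmidt_number_le d1 d1 d2 (choi_matrix d1 d2 \<Phi>)"
        using completely_positive_choi[OF cp] assms(1) by (intro schmidt_number_le_dim) simp
      show ?thesis
      \<comment> \<open>If \<open>\<Psi>\<close> is entanglement breaking, (iv) is silent about it, but then \<open>X\<close> is separable.\<close>
      proof (cases "entanglement_breaking 2 d1 \<Psi>")
        case True
        then have "schmidt_number_le 1 2 d1 X"
          using entanglement_breaking_iff[OF linP] CP by simp
        then show ?thesis
          using schmidt_number_le_id_tensor[OF lin C\<Phi>] schmidt_number_le_mono[of _ 2 d2 _ 1]
          by (metis min.cobounded2)
      next
        case False
        then have "schmidt_number_map 2 d2 (\<Phi> \<circ> \<Psi>) < schmidt_number_map 2 d1 \<Psi>"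
          using iv cpP by blast
        moreover have "schmidt_number_map 2 d1 \<Psi> \<le> 2"
          using schmidt_number_le_iff[of 2 2 d1 X] schmidt_number_le_dim[OF X]
          by (simp add: schmidt_number_map_def CP)
        ultimately have "schmidt_number 2 d2 (id_tensor 2 d1 d2 \<Phi> X) \<le> 1"
          by (simp add: schmidt_number_map_def choi_matrix_comp[OF linP] CP)
        then show ?thesis
          using schmidt_number_le_iff[of 1] completely_positive_id_tensor[OF cp X] by simp
      qed
    qed
    moreover have "k_positive 2 d1 d2 \<Phi>" using cp by (simp add: completely_positive_def)
    ultimately show ?thesis
      by (simp add: k_entanglement_breaking_def separable_iff_schmidt_number_le_1)
  qed
  have ii_iv: ?iv if ?ii using that assms(2) by auto
  have iii_iv: ?iv if iii: ?iii
  proof (intro allI impI)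
    fix \<Psi> assume \<Psi>: "completely_positive 2 d1 \<Psi> \<and> \<not> entanglement_breaking 2 d1 \<Psi>"
    then have "k_partially_entanglement_breaking 2 2 d1 \<Psi>"
      by (intro completely_positive_kraus) auto
    then have "k_partially_entanglement_breaking d2 2 d1 \<Psi>"
      by (rule k_partially_entanglement_breaking_mono) (use assms(2) in simp)
    then show "schmidt_number_map 2 d2 (\<Phi> \<circ> \<Psi>) < schmidt_number_map 2 d1 \<Psi>"
      using iii \<Psi> by blast
  qed
  have ii: ?ii if ?i using drop[OF that] by blast
  have iii: ?iii if ?i
    using drop[OF that] by (auto simp: k_partially_entanglement_breaking_def)
  have iv: ?iv if ?i using drop[OF that] by blast
  show ?thesis
    by (rule conjI[OF iffI[OF ii iv_i[OF ii_iv]] conjI[OF iffI[OF iii iv_i[OF iii_iv]] iffI[OF iv iv_i]]])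
qed

end
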